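(* An infinite binary sequence $\alpha$ is super deep if and only if $\mathrm{depth}^t_{\dim}(\alpha)>0$ for every recursive time bound $t$.
   Context: $U$ is a fixed universal prefix Turing machine; $K(x)$ is prefix Kolmogorov complexity, $Q_U(x)=\sum_{U(p)=x}2^{-|p|}$, and for a time bound $t$, $K^t(x)=\min\{|p|:U(p)=x\text{ in at most }t(|x|)\text{ steps}\}$, $Q^t_U(x)=\sum_{p:\,U(p)=x\text{ within }t(|x|)\text{ steps}}2^{-|p|}$. The logical depth of a finite string $x$ at significance level $b$ is $\mathrm{ldepth}_b(x)=\min\{t(|x|):Q^t_U(x)/Q_U(x)\ge 2^{-b}\}$ over time-constructible $t$. The randomness deficiency is $\delta(x\mid\mu)=\lfloor\log(Q_U(x)/\mu(x))\rfloor$. For an infinite sequence $\alpha$ with prefixes $\alpha_n$, $\mathrm{depth}^t_{\dim}(\alpha)=\liminf_{n\to\infty}\delta(\alpha_n\mid 2^{-K^t(\alpha_n)})/n$. A sequence $\alpha$ is super deep if for every significance level function $s:\mathbb{N}\to\mathbb{N}$ with $s=o(n)$ and every recursive function $t:\mathbb{N}\to\mathbb{N}$, for all but finitely many $n$ the prefix $\alpha_n$ satisfies $\mathrm{ldepth}_{s(n)}(\alpha_n)>t(n)$. *)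

theory Defs
  imports
    "HOL-Analysis.Analysis"
    "HOL-Library.Sublist"
    "HOL-Library.Landau_Symbols"
    "HOL-Library.Extended_Nat"
begin

section \<open>Turing machines\<close>

datatype sym = Blank | Bit bool | Mark nat

datatype dir = MoveL | Stay | MoveR

text \<open>
  A machine has \<open>tapes M\<close> two-way infinite tapes and a partial transition table. Finiteness of the
  table (\<open>is_tm\<close>) makes the sets of states and tape symbols finite. The initial state is 0; the
  machine halts when no transition applies. The input is on the first tape, the output on the last
  one (they coincide for a single-tape machine).
\<close>

record tm =
  tapes :: nat
  delta :: "nat \<times> sym list \<Rightarrow> (nat \<times> (sym \<times> dir) list) option"

definition is_tm :: "tm \<Rightarrow> bool" where
  "is_tm M \<longleftrightarrow> tapes M \<ge> 1 \<and> finite (dom (delta M)) \<and>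
     (\<forall>q ss q' as. delta M (q, ss) = Some (q', as) \<longrightarrow> length ss = tapes M \<and> length as = tapes M)"

text \<open>A tape consists of its contents and the position of the head.\<close>

type_synonym tape = "(int \<Rightarrow> sym) \<times> int"
type_synonym conf = "nat \<times> tape list"

fun scanned :: "tape \<Rightarrow> sym" where
  "scanned (f, h) = f h"

fun move :: "dir \<Rightarrow> int \<Rightarrow> int" where
  "move MoveL h = h - 1"
| "move Stay h = h"
| "move MoveR h = h + 1"

fun act :: "tape \<Rightarrow> sym \<times> dir \<Rightarrow> tape" where
  "act (f, h) (s, d) = (f(h := s), move d h)"

fun halted :: "tm \<Rightarrow> conf \<Rightarrow> bool" where
  "halted M (q, ts) \<longleftrightarrow> delta M (q, map scanned ts) = None"

fun step :: "tm \<Rightarrow> conf \<Rightarrow> conf" where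
  "step M (q, ts) =
     (case delta M (q, map scanned ts) of
        None \<Rightarrow> (q, ts)
      | Some (q', as) \<Rightarrow> (q', map2 act ts as))"

definition input_tape :: "bool list \<Rightarrow> tape" where
  "input_tape w = ((\<lambda>i. if 0 \<le> i \<and> i < int (length w) then Bit (w ! nat i) else Blank), 0)"

definition init_conf :: "tm \<Rightarrow> bool list \<Rightarrow> conf" where
  "init_conf M w = (0, input_tape w # replicate (tapes M - 1) (input_tape []))"

definition run :: "tm \<Rightarrow> bool list \<Rightarrow> nat \<Rightarrow> conf" where
  "run M w T = (step M ^^ T) (init_conf M w)"

text \<open>
  The output is the longest block of bits starting at cell 0 of the last tape. (Only finitely many
  cells of a reachable configuration are non-blank, so the \<open>LEAST\<close> is well defined.)
\<close>

fun tape_output :: "tape \<Rightarrow> bool list" where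
  "tape_output (f, h) =
     map (\<lambda>i. f (int i) = Bit True) [0..<(LEAST i. f (int i) \<notin> range Bit)]"

definition conf_output :: "conf \<Rightarrow> bool list" where
  "conf_output c = tape_output (last (snd c))"

definition computes_within :: "tm \<Rightarrow> bool list \<Rightarrow> nat \<Rightarrow> bool list \<Rightarrow> bool" where
  "computes_within M w T x \<longleftrightarrow> halted M (run M w T) \<and> conf_output (run M w T) = x"

definition computes :: "tm \<Rightarrow> bool list \<Rightarrow> bool list \<Rightarrow> bool" where
  "computes M w x \<longleftrightarrow> (\<exists>T. computes_within M w T x)"

definition runtime_is :: "tm \<Rightarrow> bool list \<Rightarrow> nat \<Rightarrow> bool" where
  "runtime_is M w T \<longleftrightarrow> halted M (run M w T) \<and> (\<forall>T'<T. \<not> halted M (run M w T'))"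

text \<open>Numbers are represented in unary.\<close>

definition recursive_fun :: "(nat \<Rightarrow> nat) \<Rightarrow> bool" where
  "recursive_fun f \<longleftrightarrow>
     (\<exists>M. is_tm M \<and> (\<forall>n. computes M (replicate n True) (replicate (f n) True)))"

definition time_constructible :: "(nat \<Rightarrow> nat) \<Rightarrow> bool" where
  "time_constructible t \<longleftrightarrow> (\<exists>M. is_tm M \<and> (\<forall>w. runtime_is M w (t (length w))))"

section \<open>Universal prefix machines\<close>

definition prefix_tm :: "tm \<Rightarrow> bool" where
  "prefix_tm M \<longleftrightarrow> is_tm M \<and>
     (\<forall>p q x y. computes M p x \<longrightarrow> computes M q y \<longrightarrow> prefix p q \<longrightarrow> p = q)"

definition universal_prefix_tm :: "tm \<Rightarrow> bool" where
  "universal_prefix_tm U \<longleftrightarrow> prefix_tm U \<and>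
     (\<forall>M. prefix_tm M \<longrightarrow> (\<exists>c. \<forall>p x. computes U (c @ p) x \<longleftrightarrow> computes M p x))"

section \<open>Algorithmic probability, complexity and depth\<close>

text \<open>The sums are finite for prefix machines by the Kraft inequality.\<close>

definition Q :: "tm \<Rightarrow> bool list \<Rightarrow> real" where
  "Q U x = (\<Sum>\<^sub>\<infinity>p\<in>{p. computes U p x}. 1 / 2 ^ length p)"

definition Q_time :: "tm \<Rightarrow> (nat \<Rightarrow> nat) \<Rightarrow> bool list \<Rightarrow> real" where
  "Q_time U t x = (\<Sum>\<^sub>\<infinity>p\<in>{p. computes_within U p (t (length x)) x}. 1 / 2 ^ length p)"

text \<open>The minimum of the empty set is \<open>\<infinity>\<close>, here and in \<open>ldepth\<close>.\<close>

definition K_time :: "tm \<Rightarrow> (nat \<Rightarrow> nat) \<Rightarrow> bool list \<Rightarrow> enat" where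
  "K_time U t x = (INF p\<in>{p. computes_within U p (t (length x)) x}. enat (length p))"

definition ldepth :: "tm \<Rightarrow> nat \<Rightarrow> bool list \<Rightarrow> enat" where
  "ldepth U b x =
     (INF t\<in>{t. time_constructible t \<and> Q_time U t x / Q U x \<ge> 1 / 2 ^ b}. enat (t (length x)))"

definition deficiency :: "tm \<Rightarrow> bool list \<Rightarrow> (bool list \<Rightarrow> real) \<Rightarrow> ereal" where
  "deficiency U x \<mu> =
     (if \<mu> x = 0 then \<infinity> else ereal (of_int \<lfloor>log 2 (Q U x / \<mu> x)\<rfloor>))"

fun two_powr_minus :: "enat \<Rightarrow> real" where
  "two_powr_minus (enat k) = 1 / 2 ^ k"
| "two_powr_minus \<infinity> = 0"

definition init_seg :: "(nat \<Rightarrow> bool) \<Rightarrow> nat \<Rightarrow> bool list" where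
  "init_seg \<alpha> n = map \<alpha> [0..<n]"

definition depth_dim :: "tm \<Rightarrow> (nat \<Rightarrow> nat) \<Rightarrow> (nat \<Rightarrow> bool) \<Rightarrow> ereal" where
  "depth_dim U t \<alpha> =
     liminf (\<lambda>n. deficiency U (init_seg \<alpha> n) (\<lambda>x. two_powr_minus (K_time U t x)) / ereal (real n))"

definition super_deep :: "tm \<Rightarrow> (nat \<Rightarrow> bool) \<Rightarrow> bool" where
  "super_deep U \<alpha> \<longleftrightarrow>
     (\<forall>s t. (\<lambda>n. real (s n)) \<in> o(\<lambda>n. real n) \<longrightarrow> recursive_fun t \<longrightarrow>
        (\<forall>\<^sub>F n in sequentially. ldepth U (s n) (init_seg \<alpha> n) > enat (t n)))"

end

theory Submission
  imports Defs "HOL-Library.Nat_Bijection" "HOL-Real_Asymp.Real_Asymp"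
begin

text \<open>
  A super deep sequence has positive dimensional depth: if \<open>\<delta>(\<alpha>\<^sub>n | 2\<^sup>-\<^sup>K)\<close>, with time bound
  \<open>t\<close>, were small compared to \<open>n\<close> along a subsequence, then with \<open>\<delta> + 1\<close> as significance level the
  depth would be at most \<open>\<tau>(n)\<close> along that subsequence, for a time-constructible \<open>\<tau> \<ge> t\<close> that has
  itself a recursive bound.

  The converse rests on a time-bounded coding theorem. By Kraft's inequality at most \<open>2\<^sup>m\<close> strings of
  length \<open>n\<close> have probability at least \<open>2\<^sup>-\<^sup>m\<close> within time \<open>t(n)\<close>, and they can be enumerated.
  Such a string is therefore given by \<open>m\<close> bits and self-delimiting codes of \<open>n\<close> and \<open>m \<le> n\<close> of length
  \<open>O(sqrt n)\<close>; the universal machine needs only a recursive time \<open>t'(n)\<close> to decode these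
  descriptions. If the depth of \<open>\<alpha>\<^sub>n\<close> at level \<open>s(n)\<close> is at most \<open>t(n)\<close>, the deficiency for the time
  bound \<open>t'\<close> is thus at most \<open>s(n) + O(sqrt n) = o(n)\<close>.

  Turing machines are kept at a distance: counter programs compile to them, and conversely they are
  simulated by functions on encoded data that counter programs compute. So the decoder, \<open>t'\<close> and \<open>\<tau>\<close>
  are obtained from closure properties of computable functions.
\<close>

section \<open>Counter programs\<close>

text \<open>\<open>universal_prefix_tm\<close> promises nothing about the time in which
  \<open>U\<close> simulates another machine, and \<open>Q\<close> is only a limit of computable
  values. Both obstacles are met by search: the decoder uses \<open>Q_time\<close> alone, and the
  new time bound at n is the least time by which, for every level m up to n, each candidate has a
  halting program of the expected length. For this the search must be finite. A program that halts
  within T steps has length at most T + 1, since otherwise a proper prefix of it would halt too; so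
  \<open>Q_time\<close> is a finite sum of dyadic fractions and can be computed exactly. The level m
  must be bounded as well, and its code has to stay short compared to n, which a bound in terms of
  t(n) would not ensure. Hence m stops at n, where n bits single out any string of length n. Super
  deepness quantifies over all significance functions in o(n), computable or not; this is what
  allows \<open>s\<close> to be read off from \<alpha> in the direction from super deep to positive
  depth.\<close>

datatype com =
    Inc nat
  | Dec nat
  | Read nat nat
  | Out bool
  | Seq com com  (infixr ";;" 60)
  | Cond nat com com
  | While nat com

type_synonym store = "nat \<Rightarrow> nat"

text \<open>A state consists of the counters, the rest of the input and the output so far.\<close>

inductive exec :: "com \<Rightarrow> store \<times> bool list \<times> bool list \<Rightarrow> store \<times> bool list \<times> bool list \<Rightarrow> bool" where
  exec_Inc: "exec (Inc v) (s, i, out) (s(v := Suc (s v)), i, out)"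
| exec_Dec: "exec (Dec v) (s, i, out) (s(v := s v - 1), i, out)"
| exec_Read_True: "exec (Read v w) (s, True # i, out) (s(v := Suc (s v)), i, out)"
| exec_Read_False: "exec (Read v w) (s, False # i, out) (s(w := Suc (s w)), i, out)"
| exec_Read_end: "exec (Read v w) (s, [], out) (s, [], out)"
| exec_Out: "exec (Out b) (s, i, out) (s, i, out @ [b])"
| exec_Seq: "exec c1 \<sigma> \<sigma>' \<Longrightarrow> exec c2 \<sigma>' \<sigma>'' \<Longrightarrow> exec (c1 ;; c2) \<sigma> \<sigma>''"
| exec_Cond_pos: "fst \<sigma> v \<noteq> 0 \<Longrightarrow> exec c1 \<sigma> \<sigma>' \<Longrightarrow> exec (Cond v c1 c2) \<sigma> \<sigma>'"
| exec_Cond_zero: "fst \<sigma> v = 0 \<Longrightarrow> exec c2 \<sigma> \<sigma>' \<Longrightarrow> exec (Cond v c1 c2) \<sigma> \<sigma>'"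
| exec_While_zero: "fst \<sigma> v = 0 \<Longrightarrow> exec (While v c) \<sigma> \<sigma>"
| exec_While_pos: "fst \<sigma> v \<noteq> 0 \<Longrightarrow> exec c \<sigma> \<sigma>' \<Longrightarrow> exec (While v c) \<sigma>' \<sigma>'' \<Longrightarrow> exec (While v c) \<sigma> \<sigma>''"

lemma exec_Inc': "s' = s(v := Suc (s v)) \<Longrightarrow> exec (Inc v) (s, i, out) (s', i, out)"
  by (simp add: exec_Inc)

lemma exec_Dec': "s' = s(v := s v - 1) \<Longrightarrow> exec (Dec v) (s, i, out) (s', i, out)"
  by (hypsubst, rule exec_Dec)

lemma exec_Read_True': "s' = s(v := Suc (s v)) \<Longrightarrow> exec (Read v w) (s, True # i, out) (s', i, out)"
  by (simp add: exec_Read_True)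

lemma exec_Read_False': "s' = s(w := Suc (s w)) \<Longrightarrow> exec (Read v w) (s, False # i, out) (s', i, out)"
  by (simp add: exec_Read_False)

lemma exec_Cond:
  "(fst \<sigma> v \<noteq> 0 \<Longrightarrow> exec c1 \<sigma> \<sigma>') \<Longrightarrow> (fst \<sigma> v = 0 \<Longrightarrow> exec c2 \<sigma> \<sigma>') \<Longrightarrow> exec (Cond v c1 c2) \<sigma> \<sigma>'"
  by (cases "fst \<sigma> v = 0") (auto intro: exec_Cond_pos exec_Cond_zero)

section \<open>Embedding programs into larger stores\<close>

primrec rename :: "(nat \<Rightarrow> nat) \<Rightarrow> com \<Rightarrow> com" where
  "rename \<rho> (Inc v) = Inc (\<rho> v)"
| "rename \<rho> (Dec v) = Dec (\<rho> v)"
| "rename \<rho> (Read v w) = Read (\<rho> v) (\<rho> w)"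
| "rename \<rho> (Out b) = Out b"
| "rename \<rho> (c1 ;; c2) = rename \<rho> c1 ;; rename \<rho> c2"
| "rename \<rho> (Cond v c1 c2) = Cond (\<rho> v) (rename \<rho> c1) (rename \<rho> c2)"
| "rename \<rho> (While v c) = While (\<rho> v) (rename \<rho> c)"

text \<open>The counters in the range of \<open>\<rho>\<close> carry the store of an embedded
  program; all others belong to the surrounding store \<open>t\<close>.\<close>

definition upd_range :: "(nat \<Rightarrow> nat) \<Rightarrow> store \<Rightarrow> store \<Rightarrow> store" where
  "upd_range \<rho> t s = (\<lambda>u. if u \<in> range \<rho> then s (inv \<rho> u) else t u)"

lemma upd_range_apply: "inj \<rho> \<Longrightarrow> upd_range \<rho> t s (\<rho> v) = s v"
  by (simp add: upd_range_def)

lemma upd_range_upd: "inj \<rho> \<Longrightarrow> (upd_range \<rho> t s)(\<rho> v := x) = upd_range \<rho> t (s(v := x))"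
  by (auto simp: upd_range_def fun_eq_iff)

text \<open>Injectivity keeps distinct counters distinct, and the renamed program never touches a
  counter outside the range of \<open>\<rho>\<close>; so an arbitrary \<open>t\<close> survives
  there as a frame.\<close>

lemma exec_rename:
  assumes "exec c \<sigma> \<sigma>'" "inj \<rho>"
  shows "exec (rename \<rho> c) (upd_range \<rho> t (fst \<sigma>), snd \<sigma>) (upd_range \<rho> t (fst \<sigma>'), snd \<sigma>')"
proof -
  note eqs = upd_range_apply[OF assms(2)] upd_range_upd[OF assms(2)]
  from assms(1) show ?thesis
  proof induction
    case (exec_Seq c1 \<sigma> \<sigma>' c2 \<sigma>'')
    then show ?case using exec.exec_Seq by simp
  next
    case (exec_Cond_pos \<sigma> v c1 \<sigma>' c2)
    then show ?case by (simp add: exec.exec_Cond_pos upd_range_apply assms(2))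
  next
    case (exec_Cond_zero \<sigma> v c2 \<sigma>' c1)
    then show ?case by (simp add: exec.exec_Cond_zero upd_range_apply assms(2))
  next
    case (exec_While_zero \<sigma> v c)
    then show ?case by (simp add: exec.exec_While_zero upd_range_apply assms(2))
  next
    case (exec_While_pos \<sigma> v c \<sigma>' \<sigma>'')
    have "fst (upd_range \<rho> t (fst \<sigma>), snd \<sigma>) (\<rho> v) \<noteq> 0"
      using exec_While_pos.hyps by (simp add: upd_range_apply assms(2))
    from exec.exec_While_pos[OF this exec_While_pos.IH(1)] exec_While_pos.IH(2)
    show ?case by simp
  next
    case (exec_Inc v s i out)
    show ?case using exec.exec_Inc[of "\<rho> v" "upd_range \<rho> t s"] by (simp only: eqs rename.simps fst_conv snd_conv)
  next
    case (exec_Dec v s i out)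
    show ?case using exec.exec_Dec[of "\<rho> v" "upd_range \<rho> t s"] by (simp only: eqs rename.simps fst_conv snd_conv)
  next
    case (exec_Read_True v w s i out)
    show ?case using exec.exec_Read_True[of "\<rho> v" "\<rho> w" "upd_range \<rho> t s"] by (simp only: eqs rename.simps fst_conv snd_conv)
  next
    case (exec_Read_False v w s i out)
    show ?case using exec.exec_Read_False[of "\<rho> v" "\<rho> w" "upd_range \<rho> t s"] by (simp only: eqs rename.simps fst_conv snd_conv)
  qed (simp_all add: exec_Read_end exec_Out)
qed

definition single :: "nat \<Rightarrow> store" where
  "single x = (\<lambda>_. 0)(0 := x)"

text \<open>The program must clean up all its scratch counters and leave input and output alone.
  This is what makes such programs composable by \<open>;;\<close> and usable inside others.\<close>

definition wc :: "(nat \<Rightarrow> nat) \<Rightarrow> bool" where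
  "wc f \<longleftrightarrow> (\<exists>c. \<forall>x i out. exec c (single x, i, out) (single (f x), i, out))"

lemma wcI: "(\<And>x i out. exec c (single x, i, out) (single (f x), i, out)) \<Longrightarrow> wc f"
  by (auto simp: wc_def)

text \<open>Choosing the program by its effect lets it be named by the function alone. Its scratch
  counters begin at \<open>N\<close>, where the store has to be zero.\<close>

definition inplace :: "(nat \<Rightarrow> nat) \<Rightarrow> nat \<Rightarrow> nat \<Rightarrow> com" where
  "inplace f v N = (SOME c. \<forall>s i out. (\<forall>u\<ge>N. s u = 0) \<longrightarrow> exec c (s, i, out) (s(v := f (s v)), i, out))"

lemma exec_inplace:
  assumes "wc f" "v < N" "\<And>u. u \<ge> N \<Longrightarrow> s u = 0" "s' = s(v := f (s v))"
  shows "exec (inplace f v N) (s, i, out) (s', i, out)"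
proof -
  \<comment> \<open>Counter 0 of the program becomes \<open>v\<close>; its scratch counters go
    beyond \<open>N\<close>, where they find the zeros they expect.\<close>
  define \<rho> where "\<rho> u = (if u = 0 then v else N + u)" for u :: nat
  have inj: "inj \<rho>"
    using assms(2) by (auto simp: \<rho>_def inj_def)
  obtain c where c: "\<And>x i out. exec c (single x, i, out) (single (f x), i, out)"
    using assms(1) by (auto simp: wc_def)
  have upd: "upd_range \<rho> s (single x) = s(v := x)" if "\<forall>u\<ge>N. s u = 0" for s x
  proof
    fix u
    consider "u = v" | "u \<noteq> v" "u \<notin> range \<rho>" | w where "w \<noteq> 0" "u = \<rho> w"
      by (metis \<rho>_def rangeE)
    then show "upd_range \<rho> s (single x) u = (s(v := x)) u"
    proof cases
      case 1
      then have "u = \<rho> 0" by (simp add: \<rho>_def)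
      then have "upd_range \<rho> s (single x) u = single x 0"
        using upd_range_apply[OF inj] by metis
      with 1 show ?thesis by (simp add: single_def)
    next
      case 2
      then show ?thesis by (simp add: upd_range_def)
    next
      case (3 w)
      then have "upd_range \<rho> s (single x) u = 0"
        using upd_range_apply[OF inj, of s "single x" w] by (simp add: single_def)
      then show ?thesis
        using 3 that assms(2) by (simp add: \<rho>_def)
    qed
  qed
  have "exec (rename \<rho> c) (s, i, out) (s(v := f (s v)), i, out)" if "\<forall>u\<ge>N. s u = 0" for s i out
    using exec_rename[OF c[of "s v" i out] inj, of s] upd[OF that] by simp
  then have "\<forall>s i out. (\<forall>u\<ge>N. s u = 0) \<longrightarrow>
      exec (inplace f v N) (s, i, out) (s(v := f (s v)), i, out)"
    unfolding inplace_def by (rule_tac someI[of _ "rename \<rho> c"]) blast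
  then show ?thesis
    using assms by simp
qed

section \<open>Elementary programs and closure properties\<close>

definition clear :: "nat \<Rightarrow> com" where
  "clear v = While v (Dec v)"

lemma exec_clear: "s' = s(v := 0) \<Longrightarrow> exec (clear v) (s, i, out) (s', i, out)"
proof (induction "s v" arbitrary: s)
  case 0
  have "s' = s"
    unfolding 0(2) by (rule fun_upd_idem) (rule 0(1)[symmetric])
  moreover have "exec (While v (Dec v)) (s, i, out) (s, i, out)"
    by (rule exec_While_zero) (simp add: 0(1)[symmetric])
  ultimately show ?case by (simp only: clear_def)
next
  case (Suc n)
  have "exec (clear v) (s(v := n), i, out) (s', i, out)"
    by (rule Suc.hyps(1)) (simp_all add: Suc.prems)
  moreover have "exec (Dec v) (s, i, out) (s(v := n), i, out)"
    by (rule exec_Dec') (simp add: Suc.hyps(2)[symmetric])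
  moreover have "fst (s, i, out) v \<noteq> 0"
    by (simp add: Suc.hyps(2)[symmetric])
  ultimately show ?case
    unfolding clear_def by (metis exec_While_pos)
qed

definition add_to :: "nat \<Rightarrow> nat \<Rightarrow> com" where
  "add_to w v = While v (Dec v ;; Inc w)"

lemma exec_add_to:
  "v \<noteq> w \<Longrightarrow> s' = s(v := 0, w := s w + s v) \<Longrightarrow> exec (add_to w v) (s, i, out) (s', i, out)"
proof (induction "s v" arbitrary: s)
  case 0
  have "s' = s"
    unfolding 0(3) 0(1)[symmetric] by (simp add: fun_upd_idem 0(1)[symmetric])
  moreover have "exec (While v (Dec v ;; Inc w)) (s, i, out) (s, i, out)"
    by (rule exec_While_zero) (simp add: 0(1)[symmetric])
  ultimately show ?case by (simp only: add_to_def)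
next
  case (Suc n)
  have "exec (add_to w v) (s(v := n, w := Suc (s w)), i, out) (s', i, out)"
    by (rule Suc.hyps(1)) (auto simp: Suc.prems Suc.hyps(2)[symmetric] fun_eq_iff)
  moreover have "exec (Dec v ;; Inc w) (s, i, out) (s(v := n, w := Suc (s w)), i, out)"
    by (rule exec_Seq[OF exec_Dec exec_Inc']) (use Suc.prems in \<open>auto simp: fun_eq_iff Suc.hyps(2)[symmetric]\<close>)
  moreover have "fst (s, i, out) v \<noteq> 0"
    by (simp add: Suc.hyps(2)[symmetric])
  ultimately show ?case
    unfolding add_to_def by (metis exec_While_pos)
qed

text \<open>A counter can only be read by draining it, so \<open>v\<close> is refilled from
  \<open>tmp\<close> afterwards.\<close>

definition copy :: "nat \<Rightarrow> nat \<Rightarrow> nat \<Rightarrow> com" where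
  "copy tmp w v = While v (Dec v ;; Inc tmp ;; Inc w) ;; add_to v tmp"

lemma exec_copy:
  assumes "distinct [v, w, tmp]" "s tmp = 0" "s w = 0" "s' = s(w := s v)"
  shows "exec (copy tmp w v) (s, i, out) (s', i, out)"
proof -
  have "exec (While v (Dec v ;; Inc tmp ;; Inc w)) (s, i, out)
      (s(v := 0, tmp := s tmp + s v, w := s w + s v), i, out)" for s
  proof (induction "s v" arbitrary: s)
    case 0
    have "s(v := 0, tmp := s tmp + s v, w := s w + s v) = s"
      by (simp add: fun_eq_iff 0[symmetric])
    moreover have "fst (s, i, out) v = 0"
      by (simp add: 0[symmetric])
    ultimately show ?case by (metis exec_While_zero)
  next
    case (Suc n)
    let ?s = "s(v := n, tmp := Suc (s tmp), w := Suc (s w))"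
    have "exec (While v (Dec v ;; Inc tmp ;; Inc w)) (?s, i, out)
      (?s(v := 0, tmp := ?s tmp + ?s v, w := ?s w + ?s v), i, out)"
      by (rule Suc.hyps(1)) (use assms in auto)
    moreover have "?s(v := 0, tmp := ?s tmp + ?s v, w := ?s w + ?s v) =
        s(v := 0, tmp := s tmp + s v, w := s w + s v)"
      using assms Suc.hyps(2) by (auto simp: fun_eq_iff)
    moreover have "exec (Dec v ;; Inc tmp ;; Inc w) (s, i, out) (?s, i, out)"
      by (rule exec_Seq[OF exec_Dec exec_Seq[OF exec_Inc exec_Inc']])
        (use assms Suc.hyps(2) in \<open>auto simp: fun_eq_iff\<close>)
    ultimately show ?case
      using Suc.hyps(2) by (metis exec_While_pos fst_conv nat.distinct(1))
  qed
  moreover have "exec (add_to v tmp) (s(v := 0, tmp := s tmp + s v, w := s w + s v), i, out) (s', i, out)"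
    by (rule exec_add_to) (use assms in \<open>auto simp: fun_eq_iff\<close>)
  ultimately show ?thesis
    unfolding copy_def by (rule exec_Seq)
qed

text \<open>There is no skip command; clearing a counter that is already zero serves as one.\<close>

lemma wc_id: "wc (\<lambda>x. x)"
  by (rule wcI[of "clear 1"]) (rule exec_clear, simp add: single_def fun_eq_iff)

lemma wc_zero: "wc (\<lambda>x. 0)"
  by (rule wcI[of "clear 0"]) (rule exec_clear, simp add: single_def fun_eq_iff)

lemma wc_Suc: "wc Suc"
  by (rule wcI[of "Inc 0"]) (rule exec_Inc', simp add: single_def fun_eq_iff)

lemma wc_pred: "wc (\<lambda>x. x - 1)"
  by (rule wcI[of "Dec 0"]) (rule exec_Dec', simp add: single_def fun_eq_iff)

lemma wc_comp: "wc f \<Longrightarrow> wc g \<Longrightarrow> wc (\<lambda>x. f (g x))"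
  unfolding wc_def by (meson exec_Seq)

lemma wc_const: "wc (\<lambda>x. c)"
  by (induction c) (auto intro: wc_zero wc_comp[OF wc_Suc])

definition pair_step :: "nat \<times> nat \<Rightarrow> nat \<times> nat" where
  "pair_step = (\<lambda>(a, b). if b = 0 then (0, Suc a) else (Suc a, b - 1))"

text \<open>The enumeration of pairs underlying \<open>prod_encode\<close>: successors run along the diagonals.\<close>

lemma prod_encode_pair_step: "prod_encode (pair_step p) = Suc (prod_encode p)"
proof (cases p)
  case (Pair a b)
  show ?thesis
  proof (cases b)
    case 0
    then show ?thesis
      by (simp add: Pair pair_step_def prod_encode_def triangle_Suc)
  next
    case (Suc c)
    then show ?thesis
      by (simp add: Pair pair_step_def prod_encode_def)
  qed
qed

lemma prod_decode_Suc: "prod_decode (Suc n) = pair_step (prod_decode n)"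
  by (metis prod_encode_pair_step prod_decode_inverse prod_encode_inverse)

definition two :: "nat \<Rightarrow> nat \<Rightarrow> store" where
  "two a b = (\<lambda>_. 0)(0 := a, 1 := b)"

lemma single_eq_two: "single x = two x 0"
  by (simp add: single_def two_def fun_eq_iff)

text \<open>Inverting the pairing needs no arithmetic this way: counters 2 and 1 hold a pair that
  starts at (0, 0) and makes one \<open>pair_step\<close> for each unit taken from counter
  0.\<close>

definition unpair :: com where
  "unpair = While 0 (Dec 0 ;; Cond 2 (Dec 2 ;; Inc 1) (Inc 2 ;; add_to 2 1)) ;; add_to 0 1 ;; add_to 1 2"

lemma exec_unpair:
  "exec unpair (single x, i, out) (two (fst (prod_decode x)) (snd (prod_decode x)), i, out)"
proof -
  let ?st = "\<lambda>x (a, b). (\<lambda>_. 0)(0 := x, 1 := a, 2 := b) :: store"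
  let ?c = "Dec 0 ;; Cond 2 (Dec 2 ;; Inc 1) (Inc 2 ;; add_to 2 1)"
  have body: "exec ?c (?st (Suc x) p, i, out) (?st x (pair_step p), i, out)" for x p
  proof -
    obtain a b where p: "p = (a, b)" by force
    have "exec (Cond 2 (Dec 2 ;; Inc 1) (Inc 2 ;; add_to 2 1)) (?st x p, i, out) (?st x (pair_step p), i, out)"
    proof (rule exec_Cond)
      assume "fst (?st x p, i, out) 2 \<noteq> 0"
      then show "exec (Dec 2 ;; Inc 1) (?st x p, i, out) (?st x (pair_step p), i, out)"
        by (intro exec_Seq[OF exec_Dec exec_Inc']) (auto simp: p pair_step_def fun_eq_iff)
    next
      assume "fst (?st x p, i, out) 2 = 0"
      then show "exec (Inc 2 ;; add_to 2 1) (?st x p, i, out) (?st x (pair_step p), i, out)"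
        by (intro exec_Seq[OF exec_Inc exec_add_to]) (auto simp: p pair_step_def fun_eq_iff)
    qed
    then show ?thesis
      by (intro exec_Seq[OF exec_Dec']) (auto simp: p fun_eq_iff)
  qed
  have loop: "exec (While 0 ?c) (?st x p, i, out) (?st 0 ((pair_step ^^ x) p), i, out)" for p
  proof (induction x arbitrary: p)
    case 0
    show ?case by (cases p) (auto intro: exec_While_zero)
  next
    case (Suc x)
    show ?case
    proof -
      have "fst (?st (Suc x) p, i, out) 0 \<noteq> 0" by (cases p) simp
      from exec_While_pos[OF this body Suc.IH] show ?thesis
        by (simp only: funpow_Suc_right o_apply)
    qed
  qed
  have "(pair_step ^^ x) (prod_decode 0) = prod_decode x"
    by (induction x) (auto simp: prod_decode_Suc)
  moreover have "prod_decode 0 = (0, 0)"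
    by (simp add: prod_decode_def prod_decode_aux.simps)
  ultimately have "(pair_step ^^ x) (0, 0) = prod_decode x" by simp
  then have 1: "exec (While 0 ?c) (single x, i, out) (?st 0 (prod_decode x), i, out)"
    using loop[of "(0, 0)"] by (simp add: single_def fun_upd_idem)
  obtain a b where ab: "prod_decode x = (a, b)" by force
  have 2: "exec (add_to 0 1 ;; add_to 1 2) (?st 0 (prod_decode x), i, out)
      (two (fst (prod_decode x)) (snd (prod_decode x)), i, out)"
    by (rule exec_Seq[OF exec_add_to[OF _ refl] exec_add_to]) (auto simp: ab two_def fun_eq_iff)
  show ?thesis
    unfolding unpair_def by (rule exec_Seq[OF 1 2])
qed

text \<open>Counter 3 is zero exactly when both 0 and 1 are; the loop walks the diagonals backwards.\<close>

definition pair_up :: com where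
  "pair_up =
     (Cond 0 (Inc 3) (Cond 1 (Inc 3) (clear 3))) ;;
     While 3 (Inc 2 ;; Cond 0 (Dec 0 ;; Inc 1) (Dec 1 ;; add_to 0 1) ;;
       Dec 3 ;; Cond 0 (Inc 3) (Cond 1 (Inc 3) (clear 3))) ;;
     add_to 0 2"

lemma exec_pair_up: "exec pair_up (two a b, i, out) (single (prod_encode (a, b)), i, out)"
proof -
  define st :: "nat \<Rightarrow> nat \<Rightarrow> nat \<Rightarrow> nat \<Rightarrow> store" where "st r a b f = (\<lambda>_. 0)(0 := a, 1 := b, 2 := r, 3 := f)" for r a b f
  define pos :: "nat \<Rightarrow> nat \<Rightarrow> nat" where "pos a b = (if a = 0 \<and> b = 0 then 0 else 1)" for a b
  let ?test = "Cond 0 (Inc 3) (Cond 1 (Inc 3) (clear 3))"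
  let ?prev = "Cond 0 (Dec 0 ;; Inc 1) (Dec 1 ;; add_to 0 1)"
  let ?body = "Inc 2 ;; ?prev ;; Dec 3 ;; ?test"
  have test: "exec ?test (st r a b 0, i, out) (st r a b (pos a b), i, out)" for r a b
    by (intro exec_Cond exec_Inc' exec_clear) (auto simp: st_def pos_def fun_eq_iff)
  \<comment> \<open>One round undoes one \<open>pair_step\<close>: (0, b) goes back to (b - 1, 0),
    and (a, b) with positive a to (a - 1, b + 1). The flag is 1 on entry because a successor pair is
    never (0, 0).\<close>
  have body: "exec ?body (st r (fst (pair_step (a, b))) (snd (pair_step (a, b))) 1, i, out)
      (st (Suc r) a b (pos a b), i, out)" for r a b
  proof -
    have "exec ?prev (st (Suc r) (fst (pair_step (a, b))) (snd (pair_step (a, b))) 1, i, out)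
        (st (Suc r) a b 1, i, out)"
    proof (rule exec_Cond)
      assume "fst (st (Suc r) (fst (pair_step (a, b))) (snd (pair_step (a, b))) 1, i, out) 0 \<noteq> 0"
      then show "exec (Dec 0 ;; Inc 1)
          (st (Suc r) (fst (pair_step (a, b))) (snd (pair_step (a, b))) 1, i, out)
          (st (Suc r) a b 1, i, out)"
        by (intro exec_Seq[OF exec_Dec exec_Inc'])
          (auto simp: st_def pair_step_def fun_eq_iff split: if_splits)
    next
      assume "fst (st (Suc r) (fst (pair_step (a, b))) (snd (pair_step (a, b))) 1, i, out) 0 = 0"
      then show "exec (Dec 1 ;; add_to 0 1)
          (st (Suc r) (fst (pair_step (a, b))) (snd (pair_step (a, b))) 1, i, out)
          (st (Suc r) a b 1, i, out)"
        by (intro exec_Seq[OF exec_Dec exec_add_to])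
          (auto simp: st_def pair_step_def fun_eq_iff split: if_splits)
    qed
    moreover have "exec (Dec 3) (st (Suc r) a b 1, i, out) (st (Suc r) a b 0, i, out)"
      by (rule exec_Dec') (auto simp: st_def fun_eq_iff)
    moreover have "exec (Inc 2) (st r (fst (pair_step (a, b))) (snd (pair_step (a, b))) 1, i, out)
        (st (Suc r) (fst (pair_step (a, b))) (snd (pair_step (a, b))) 1, i, out)"
      by (rule exec_Inc') (auto simp: st_def fun_eq_iff)
    ultimately show ?thesis
      using exec_Seq[OF _ exec_Seq[OF _ exec_Seq[OF _ test]]] by blast
  qed
  have loop: "exec (While 3 ?body) (st r a b (pos a b), i, out) (st (r + prod_encode (a, b)) 0 0 0, i, out)"
    for r a b
  proof (induction "prod_encode (a, b)" arbitrary: r a b)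
    case 0
    then have "(a, b) = prod_decode 0" by (metis prod_encode_inverse)
    then have "a = 0" "b = 0" by (auto simp: prod_decode_def prod_decode_aux.simps)
    moreover have "prod_encode (0, 0) = 0" by (simp add: prod_encode_def)
    ultimately show ?case by (auto simp: pos_def st_def intro!: exec_While_zero)
  next
    case (Suc n)
    obtain a' b' where ab': "prod_decode n = (a', b')" by force
    have ab: "(a, b) = pair_step (a', b')"
      by (metis Suc.hyps(2) ab' prod_decode_Suc prod_encode_inverse)
    then have pos: "pos a b = 1"
      by (auto simp: pos_def pair_step_def split: if_splits)
    have n: "n = prod_encode (a', b')"
      by (metis ab' prod_decode_inverse)
    have W: "exec (While 3 ?body) (st (Suc r) a' b' (pos a' b'), i, out)
        (st (Suc r + prod_encode (a', b')) 0 0 0, i, out)"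
      by (rule Suc.hyps(1)) (rule n)
    have B: "exec ?body (st r a b 1, i, out) (st (Suc r) a' b' (pos a' b'), i, out)"
      using body[of r a' b'] ab by (metis fst_conv snd_conv)
    have "exec (While 3 ?body) (st r a b 1, i, out)
        (st (Suc r + prod_encode (a', b')) 0 0 0, i, out)"
      by (rule exec_While_pos[OF _ B W]) (simp add: st_def)
    moreover have "Suc r + prod_encode (a', b') = r + prod_encode (a, b)"
      using Suc.hyps(2) n by simp
    ultimately show ?case
      by (simp only: pos)
  qed
  have "two a b = st 0 a b 0"
    by (auto simp: two_def st_def fun_eq_iff)
  moreover have "exec (add_to 0 2) (st (0 + prod_encode (a, b)) 0 0 0, i, out)
      (single (prod_encode (a, b)), i, out)"
    by (rule exec_add_to) (auto simp: st_def single_def fun_eq_iff)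
  ultimately show ?thesis
    unfolding pair_up_def using exec_Seq[OF test exec_Seq[OF loop[of 0]]] by simp
qed

lemma wc_fst: "wc (\<lambda>x. fst (prod_decode x))"
  by (rule wcI[of "unpair ;; clear 1"])
    (rule exec_Seq[OF exec_unpair exec_clear], auto simp: two_def single_def fun_eq_iff)

lemma wc_snd: "wc (\<lambda>x. snd (prod_decode x))"
  by (rule wcI[of "unpair ;; clear 0 ;; add_to 0 1"])
    (rule exec_Seq[OF exec_unpair exec_Seq[OF exec_clear[OF refl] exec_add_to]],
      auto simp: two_def single_def fun_eq_iff)

section \<open>Pairing, branching, iteration and unbounded search\<close>

lemma wc_pair:
  assumes "wc f" "wc g"
  shows "wc (\<lambda>x. prod_encode (f x, g x))"
proof (rule wcI)
  fix x i out
  show "exec (copy 2 1 0 ;; inplace f 0 2 ;; inplace g 1 2 ;; pair_up) (single x, i, out)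
      (single (prod_encode (f x, g x)), i, out)"
  proof (intro exec_Seq)
    show "exec pair_up (two (f x) (g x), i, out) (single (prod_encode (f x, g x)), i, out)"
      by (rule exec_pair_up)
    show "exec (copy 2 1 0) (single x, i, out) (two x x, i, out)"
      by (rule exec_copy) (auto simp: single_def two_def fun_eq_iff)
    show "exec (inplace f 0 2) (two x x, i, out) (two (f x) x, i, out)"
      by (rule exec_inplace[OF assms(1)]) (auto simp: two_def fun_eq_iff)
    show "exec (inplace g 1 2) (two (f x) x, i, out) (two (f x) (g x), i, out)"
      by (rule exec_inplace[OF assms(2)]) (auto simp: two_def fun_eq_iff)
  qed
qed

lemma wc_if:
  assumes "wc p" "wc f" "wc g"
  shows "wc (\<lambda>x. if p x \<noteq> 0 then f x else g x)"
proof (rule wcI)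
  fix x i out
  show "exec (copy 2 1 0 ;; inplace p 1 2 ;; Cond 1 (clear 1 ;; inplace f 0 2) (inplace g 0 2))
      (single x, i, out) (single (if p x \<noteq> 0 then f x else g x), i, out)"
  proof (intro exec_Seq exec_Cond)
    show "exec (copy 2 1 0) (single x, i, out) (two x x, i, out)"
      by (rule exec_copy) (auto simp: single_def two_def fun_eq_iff)
    show "exec (inplace p 1 2) (two x x, i, out) (two x (p x), i, out)"
      by (rule exec_inplace[OF assms(1)]) (auto simp: two_def fun_eq_iff)
    show "exec (clear 1) (two x (p x), i, out) (two x 0, i, out)"
      by (rule exec_clear) (auto simp: two_def fun_eq_iff)
    show "exec (inplace f 0 2) (two x 0, i, out) (single (if p x \<noteq> 0 then f x else g x), i, out)"
      if "fst (two x (p x), i, out) 1 \<noteq> 0"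
      by (rule exec_inplace[OF assms(2)]) (use that in \<open>auto simp: two_def single_def fun_eq_iff\<close>)
    show "exec (inplace g 0 2) (two x (p x), i, out) (single (if p x \<noteq> 0 then f x else g x), i, out)"
      if "fst (two x (p x), i, out) 1 = 0"
      by (rule exec_inplace[OF assms(3)]) (use that in \<open>auto simp: two_def single_def fun_eq_iff\<close>)
  qed
qed

lemma wc_iterate:
  assumes "wc f"
  shows "wc (\<lambda>x. (f ^^ fst (prod_decode x)) (snd (prod_decode x)))"
proof (rule wcI)
  fix x i out
  let ?c = "Dec 0 ;; inplace f 1 2"
  have loop: "exec (While 0 ?c) (two n y, i, out) (two 0 ((f ^^ n) y), i, out)" for n y
  proof (induction n arbitrary: y)
    case 0
    show ?case by (auto intro: exec_While_zero simp: two_def)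
  next
    case (Suc n)
    have "exec ?c (two (Suc n) y, i, out) (two n (f y), i, out)"
      by (rule exec_Seq[OF exec_Dec exec_inplace[OF assms]]) (auto simp: two_def fun_eq_iff)
    with Suc.IH[of "f y"] show ?case
      by (auto intro!: exec_While_pos[where \<sigma>' = "(two n (f y), i, out)"] simp: funpow_swap1)
        (simp add: two_def)
  qed
  show "exec (unpair ;; While 0 ?c ;; add_to 0 1) (single x, i, out)
      (single ((f ^^ fst (prod_decode x)) (snd (prod_decode x))), i, out)"
    by (rule exec_Seq[OF exec_unpair exec_Seq[OF loop exec_add_to]])
      (auto simp: two_def single_def fun_eq_iff)
qed

text \<open>Unbounded search, the closure property that goes beyond iterating a number of times
  known in advance. Termination is assumed for every argument, so that the result is total.\<close>

lemma wc_while: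
  assumes "wc f" "wc p" "wc a" "\<And>x. \<exists>k. p ((f ^^ k) (a x)) = 0"
  shows "wc (\<lambda>x. (f ^^ (LEAST k. p ((f ^^ k) (a x)) = 0)) (a x))"
proof (rule wcI)
  fix x i out
  let ?test = "copy 2 1 0 ;; inplace p 1 2"
  let ?c = "clear 1 ;; inplace f 0 2 ;; ?test"
  have test: "exec ?test (single x, i, out) (two x (p x), i, out)" for x
  proof (rule exec_Seq)
    show "exec (copy 2 1 0) (single x, i, out) (two x x, i, out)"
      by (rule exec_copy) (auto simp: single_def two_def fun_eq_iff)
    show "exec (inplace p 1 2) (two x x, i, out) (two x (p x), i, out)"
      by (rule exec_inplace[OF assms(2)]) (auto simp: two_def fun_eq_iff)
  qed
  have body: "exec ?c (two x (p x), i, out) (two (f x) (p (f x)), i, out)" for x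
  proof (intro exec_Seq[OF _ exec_Seq[OF _ test]])
    show "exec (clear 1) (two x (p x), i, out) (single x, i, out)"
      by (rule exec_clear) (auto simp: two_def single_def fun_eq_iff)
    show "exec (inplace f 0 2) (single x, i, out) (single (f x), i, out)"
      by (rule exec_inplace[OF assms(1)]) (auto simp: single_def fun_eq_iff)
  qed
  have loop: "exec (While 1 ?c) (two x (p x), i, out) (single ((f ^^ k) x), i, out)"
    if "p ((f ^^ k) x) = 0" "\<And>j. j < k \<Longrightarrow> p ((f ^^ j) x) \<noteq> 0" for k x
    using that
  proof (induction k arbitrary: x)
    case 0
    then show ?case by (auto intro: exec_While_zero simp: single_eq_two) (simp add: two_def exec_While_zero)
  next
    case (Suc k)
    have "exec (While 1 ?c) (two (f x) (p (f x)), i, out) (single ((f ^^ k) (f x)), i, out)"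
    proof (rule Suc.IH)
      show "p ((f ^^ k) (f x)) = 0" using Suc.prems(1) by (simp add: funpow_swap1)
      show "p ((f ^^ j) (f x)) \<noteq> 0" if "j < k" for j
        using Suc.prems(2)[of "Suc j"] that by (simp add: funpow_swap1)
    qed
    moreover have "p x \<noteq> 0" using Suc.prems(2)[of 0] by simp
    ultimately show ?case
      using body[of x]
      by (auto intro!: exec_While_pos[where \<sigma>' = "(two (f x) (p (f x)), i, out)"] simp: funpow_swap1)
        (simp add: two_def)
  qed
  let ?k = "LEAST k. p ((f ^^ k) (a x)) = 0"
  have "exec (While 1 ?c) (two (a x) (p (a x)), i, out) (single ((f ^^ ?k) (a x)), i, out)"
  proof (rule loop)
    show "p ((f ^^ ?k) (a x)) = 0" using assms(4)[of x] by (rule LeastI_ex)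
    show "p ((f ^^ j) (a x)) \<noteq> 0" if "j < ?k" for j using not_less_Least[OF that] .
  qed
  moreover have "exec (inplace a 0 1) (single x, i, out) (single (a x), i, out)"
    by (rule exec_inplace[OF assms(3)]) (auto simp: single_def fun_eq_iff)
  ultimately show "exec (inplace a 0 1 ;; ?test ;; While 1 ?c) (single x, i, out)
      (single ((f ^^ ?k) (a x)), i, out)"
    using exec_Seq[OF _ exec_Seq[OF test]] by blast
qed

section \<open>Computable functions on encoded data\<close>

text \<open>Injectivity turns equality tests on data of any type into comparisons of
  numbers.\<close>

class enc =
  fixes enc :: "'a \<Rightarrow> nat"
  assumes enc_eq_iff: "enc x = enc y \<longleftrightarrow> x = y"

instantiation nat :: enc
begin
definition "enc_nat = (\<lambda>n::nat. n)"
instance by standard (simp add: enc_nat_def)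
end

instantiation bool :: enc
begin
definition "enc_bool = (\<lambda>b. if b then 1 else 0 :: nat)"
instance by standard (simp add: enc_bool_def)
end

instantiation prod :: (enc, enc) enc
begin
definition "enc_prod p = prod_encode (enc (fst p), enc (snd p))"
instance by standard (auto simp: enc_prod_def enc_eq_iff prod_eq_iff)
end

instantiation list :: (enc) enc
begin
definition "enc_list xs = list_encode (map enc xs)"
instance
  by standard (simp add: enc_list_def inj_eq[OF inj_list_encode] inj_map_eq_map inj_def enc_eq_iff)
end

instantiation option :: (enc) enc
begin
definition "enc_option x = (case x of None \<Rightarrow> 0 | Some y \<Rightarrow> Suc (enc y))"
instance by standard (auto simp: enc_option_def enc_eq_iff split: option.split)
end

instantiation int :: enc
begin
definition "enc_int = int_encode"
instance by standard (simp add: enc_int_def inj_eq[OF inj_int_encode])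
end

instantiation sym :: enc
begin
definition "enc_sym s = (case s of Blank \<Rightarrow> 0 | Bit b \<Rightarrow> if b then 1 else 2 | Mark n \<Rightarrow> n + 3)"
instance by standard (auto simp: enc_sym_def split: sym.split)
end

instantiation dir :: enc
begin
definition "enc_dir d = (case d of MoveL \<Rightarrow> 0 :: nat | Stay \<Rightarrow> 1 | MoveR \<Rightarrow> 2)"
instance by standard (auto simp: enc_dir_def split: dir.split)
end

lemma enc_Pair: "enc (a, b) = prod_encode (enc a, enc b)"
  by (simp add: enc_prod_def)

lemma enc_Nil: "enc [] = 0"
  by (simp add: enc_list_def)

lemma enc_Cons: "enc (x # xs) = Suc (prod_encode (enc x, enc xs))"
  by (simp add: enc_list_def)

lemma length_le_enc: "length xs \<le> enc xs"
proof (induction xs)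
  case (Cons x xs)
  have "enc xs \<le> prod_encode (enc x, enc xs)" by (rule le_prod_encode_2)
  with Cons show ?case by (simp add: enc_Cons)
qed simp

text \<open>The numerical function \<open>g\<close> is constrained on codes only; on numbers that
  encode nothing it may do anything.\<close>

definition cf :: "('a::enc \<Rightarrow> 'b::enc) \<Rightarrow> bool" where
  "cf f \<longleftrightarrow> (\<exists>g. wc g \<and> (\<forall>x. g (enc x) = enc (f x)))"

named_theorems cf_intros

lemma cfI: "wc g \<Longrightarrow> (\<And>x. g (enc x) = enc (f x)) \<Longrightarrow> cf f"
  by (auto simp: cf_def)

lemma cfE:
  assumes "cf f"
  obtains g where "wc g" "\<And>x. g (enc x) = enc (f x)"
  using assms by (auto simp: cf_def)

lemma cf_id [cf_intros]: "cf (\<lambda>x. x)"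
  by (rule cfI[OF wc_id]) simp

lemma cf_const [cf_intros]: "cf (\<lambda>_. c)"
  by (rule cfI[OF wc_const]) simp

lemma cf_comp: "cf f \<Longrightarrow> cf g \<Longrightarrow> cf (\<lambda>x. f (g x))"
  unfolding cf_def by (metis wc_comp)

lemma cf_Pair [cf_intros]:
  assumes "cf f" "cf g"
  shows "cf (\<lambda>x. (f x, g x))"
proof -
  from assms obtain f' g' where "wc f'" "\<And>x. f' (enc x) = enc (f x)"
    "wc g'" "\<And>x. g' (enc x) = enc (g x)"
    by (meson cfE)
  then show ?thesis
    by (intro cfI[OF wc_pair, of f' g']) (auto simp: enc_Pair)
qed

lemma cf_comp2:
  assumes "cf (\<lambda>z. F (fst z) (snd z))" "cf f" "cf g"
  shows "cf (\<lambda>x. F (f x) (g x))"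
  using cf_comp[OF assms(1) cf_Pair[OF assms(2,3)]] by simp

lemma cf_fst [cf_intros]: "cf f \<Longrightarrow> cf (\<lambda>x. fst (f x))"
  by (rule cf_comp[of fst]) (rule cfI[OF wc_fst], simp add: enc_prod_def)

lemma cf_snd [cf_intros]: "cf f \<Longrightarrow> cf (\<lambda>x. snd (f x))"
  by (rule cf_comp[of snd]) (rule cfI[OF wc_snd], simp add: enc_prod_def)

lemma cf_Suc [cf_intros]: "cf f \<Longrightarrow> cf (\<lambda>x. Suc (f x))"
  by (rule cf_comp[of Suc]) (rule cfI[OF wc_Suc], simp add: enc_nat_def)

lemma cf_pred: "cf f \<Longrightarrow> cf (\<lambda>x. f x - (1::nat))"
  by (rule cf_comp[of "\<lambda>x. x - 1"]) (rule cfI[OF wc_pred], simp add: enc_nat_def)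

lemma cf_enc [cf_intros]: "cf f \<Longrightarrow> cf (\<lambda>x. enc (f x))"
  by (rule cf_comp[of enc]) (rule cfI[OF wc_id], simp add: enc_nat_def)

lemma cf_if [cf_intros]:
  assumes "cf P" "cf f" "cf g"
  shows "cf (\<lambda>x. if P x then f x else g x)"
proof -
  from assms obtain p f' g' where "wc p" "\<And>x. p (enc x) = enc (P x)"
    "wc f'" "\<And>x. f' (enc x) = enc (f x)" "wc g'" "\<And>x. g' (enc x) = enc (g x)"
    by (meson cfE)
  then show ?thesis
    by (intro cfI[OF wc_if[of p f' g']]) (auto simp: enc_bool_def)
qed

lemma cf_funpow [cf_intros]:
  fixes G :: "'a::enc \<Rightarrow> 'b::enc \<Rightarrow> 'b"
  assumes "cf (\<lambda>z. G (fst z) (snd z))" "cf n" "cf a"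
  shows "cf (\<lambda>x. ((\<lambda>s. G x s) ^^ n x) (a x))"
proof -
  obtain g where g: "wc g" "\<And>z. g (enc z) = enc (G (fst z) (snd z))"
    using assms(1) by (rule cfE) blast
  \<comment> \<open>\<open>wc_iterate\<close> knows no parameters, so x travels along as the first
    component of the state.\<close>
  let ?h = "\<lambda>z. prod_encode (fst (prod_decode z), g z)"
  have iter: "(?h ^^ k) (enc (x, s)) = enc (x, (G x ^^ k) s)" for k x s
  proof (induction k)
    case (Suc k)
    have "?h (enc (x, (G x ^^ k) s)) = enc (x, G x ((G x ^^ k) s))"
      using g(2)[of "(x, (G x ^^ k) s)"] by (simp add: enc_Pair)
    with Suc show ?case by simp
  qed simp
  have "wc ?h"
    by (intro wc_pair wc_fst g(1))
  then have "wc (\<lambda>z. (?h ^^ fst (prod_decode z)) (snd (prod_decode z)))"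
    by (rule wc_iterate)
  then have "cf (\<lambda>z :: nat \<times> 'a \<times> 'b. (fst (snd z), (G (fst (snd z)) ^^ fst z) (snd (snd z))))"
    by (rule cfI) (auto simp: enc_Pair enc_nat_def iter[unfolded enc_Pair])
  moreover have "cf (\<lambda>x. (n x, x, a x))"
    by (intro cf_intros assms)
  ultimately have "cf (\<lambda>x. (fst (snd (n x, x, a x)),
      (G (fst (snd (n x, x, a x))) ^^ fst (n x, x, a x)) (snd (snd (n x, x, a x)))))"
    by (rule cf_comp)
  from cf_snd[OF this] show ?thesis by simp
qed

lemma cf_add [cf_intros]: "cf f \<Longrightarrow> cf g \<Longrightarrow> cf (\<lambda>x. f x + g x :: nat)"
  using cf_funpow[of "\<lambda>_ s. Suc s" f g] by (simp add: cf_intros)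

lemma cf_diff [cf_intros]:
  assumes "cf f" "cf g"
  shows "cf (\<lambda>x. f x - g x :: nat)"
proof -
  have *: "((\<lambda>s. s - 1) ^^ n) m = m - n" for m n :: nat
    by (induction n) auto
  have "cf (\<lambda>x. ((\<lambda>s. s - 1) ^^ g x) (f x))"
    by (intro cf_intros cf_pred assms)
  then show ?thesis by (simp only: *)
qed

lemma cf_mult [cf_intros]:
  assumes "cf f" "cf g"
  shows "cf (\<lambda>x. f x * g x :: nat)"
proof -
  have *: "((\<lambda>s. s + n) ^^ m) 0 = m * n" for m n :: nat
    by (induction m) auto
  have "cf (\<lambda>x. ((\<lambda>s. s + g x) ^^ f x) 0)"
    by (intro cf_intros cf_comp[OF assms(1)] cf_comp[OF assms(2)])
  then show ?thesis by (simp only: *)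
qed

lemma cf_power [cf_intros]:
  assumes "cf f" "cf g"
  shows "cf (\<lambda>x. f x ^ g x :: nat)"
proof -
  have *: "((\<lambda>s. s * n) ^^ m) 1 = n ^ m" for m n :: nat
    by (induction m) auto
  have "cf (\<lambda>x. ((\<lambda>s. s * f x) ^^ g x) 1)"
    by (intro cf_intros cf_comp[OF assms(1)] cf_comp[OF assms(2)])
  then show ?thesis by (simp only: *)
qed

lemma cf_conj [cf_intros]: "cf P \<Longrightarrow> cf R \<Longrightarrow> cf (\<lambda>x. P x \<and> R x)"
proof -
  have "(\<lambda>x. P x \<and> R x) = (\<lambda>x. if P x then R x else False)"
    by auto
  then show "cf P \<Longrightarrow> cf R \<Longrightarrow> ?thesis"
    by (simp only:) (intro cf_if cf_const)
qed

lemma cf_not [cf_intros]: "cf P \<Longrightarrow> cf (\<lambda>x. \<not> P x)"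
proof -
  have "(\<lambda>x. \<not> P x) = (\<lambda>x. if P x then False else True)"
    by auto
  then show "cf P \<Longrightarrow> ?thesis"
    by (simp only:) (intro cf_if cf_const)
qed

lemma cf_disj [cf_intros]: "cf P \<Longrightarrow> cf R \<Longrightarrow> cf (\<lambda>x. P x \<or> R x)"
proof -
  have "(\<lambda>x. P x \<or> R x) = (\<lambda>x. if P x then True else R x)"
    by auto
  then show "cf P \<Longrightarrow> cf R \<Longrightarrow> ?thesis"
    by (simp only:) (intro cf_if cf_const)
qed

lemma cf_le [cf_intros]:
  assumes "cf f" "cf g"
  shows "cf (\<lambda>x. f x \<le> (g x :: nat))"
proof -
  have "cf (\<lambda>n::nat. n = 0)"
    by (rule cfI[OF wc_if[OF wc_id wc_const wc_const, of 0 1]])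
      (simp add: enc_nat_def enc_bool_def)
  from cf_comp[OF this cf_diff[OF assms]] show ?thesis by simp
qed

lemma cf_eq [cf_intros]:
  assumes "cf f" "cf g"
  shows "cf (\<lambda>x. f x = g x)"
proof -
  have "cf (\<lambda>x. enc (f x) \<le> enc (g x) \<and> enc (g x) \<le> enc (f x))"
    by (intro cf_conj cf_le cf_enc assms)
  then show ?thesis by (simp only: order.eq_iff[symmetric] enc_eq_iff)
qed

text \<open>The search state is the pair of n and a counter that runs upwards from 0, so the first
  hit of \<open>wc_while\<close> is the least witness. Halting times, and with them the time bound
  of the coding theorem, are computed this way.\<close>

lemma cf_Least:
  fixes P :: "nat \<Rightarrow> nat \<Rightarrow> bool"
  assumes "cf (\<lambda>z. P (fst z) (snd z))" and ex: "\<And>n. \<exists>k. P n k"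
  shows "cf (\<lambda>n. LEAST k. P n k)"
proof -
  have "cf (\<lambda>z. \<not> P (fst z) (snd z))"
    by (intro cf_intros assms)
  then obtain p where p: "wc p" "\<And>z. p (enc z) = enc (\<not> P (fst z) (snd z))"
    by (rule cfE) blast
  let ?f = "\<lambda>z. prod_encode (fst (prod_decode z), Suc (snd (prod_decode z)))"
  let ?a = "\<lambda>n. prod_encode (n, 0)"
  have iter: "(?f ^^ k) (?a n) = prod_encode (n, k)" for k n
    by (induction k) auto
  have p': "p (prod_encode (n, k)) = 0 \<longleftrightarrow> P n k" for n k
    using p(2)[of "(n, k)"] by (simp add: enc_Pair enc_nat_def enc_bool_def split: if_splits)
  have "wc (\<lambda>n. (?f ^^ (LEAST k. p ((?f ^^ k) (?a n)) = 0)) (?a n))"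
    by (rule wc_while)
      (auto simp: iter p' ex intro!: wc_pair wc_fst wc_comp[OF wc_Suc wc_snd] wc_id wc_const p)
  from wc_comp[OF wc_snd this] show ?thesis
    by (rule cfI) (simp add: iter p' enc_nat_def)
qed

subsection \<open>Lists\<close>

lemma cf_Cons [cf_intros]:
  assumes "cf f" "cf g"
  shows "cf (\<lambda>x. f x # g x)"
proof -
  from assms obtain f' g' where "wc f'" "\<And>x. f' (enc x) = enc (f x)"
    "wc g'" "\<And>x. g' (enc x) = enc (g x)"
    by (meson cfE)
  then show ?thesis
    by (intro cfI[OF wc_comp[OF wc_Suc wc_pair], of f' g']) (auto simp: enc_Cons)
qed

lemma cf_hd [cf_intros]: "cf f \<Longrightarrow> cf (\<lambda>x. hd (f x))"
proof (rule cf_comp[of hd])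
  show "cf (hd :: 'b list \<Rightarrow> 'b)"
  proof (rule cfI)
    \<comment> \<open>\<open>hd []\<close> is unspecified but fixed, so its code is a constant of
      the program.\<close>
    show "wc (\<lambda>x. if x \<noteq> 0 then fst (prod_decode (x - 1)) else enc (hd [] :: 'b))"
      by (intro wc_if wc_id wc_comp[OF wc_fst wc_pred] wc_const)
    show "(if enc xs \<noteq> 0 then fst (prod_decode (enc xs - 1)) else enc (hd [] :: 'b)) = enc (hd xs)"
      for xs :: "'b list"
      by (cases xs) (auto simp: enc_Nil enc_Cons)
  qed
qed

lemma cf_tl [cf_intros]: "cf f \<Longrightarrow> cf (\<lambda>x. tl (f x))"
proof (rule cf_comp[of tl])
  show "cf (tl :: 'b list \<Rightarrow> 'b list)"
  proof (rule cfI)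
    show "wc (\<lambda>x. if x \<noteq> 0 then snd (prod_decode (x - 1)) else 0)"
      by (intro wc_if wc_id wc_comp[OF wc_snd wc_pred] wc_const)
    show "(if enc xs \<noteq> 0 then snd (prod_decode (enc xs - 1)) else 0) = enc (tl xs)"
      for xs :: "'b list"
      by (cases xs) (auto simp: enc_Nil enc_Cons)
  qed
qed

lemma cf_fold [cf_intros]:
  assumes "cf (\<lambda>z. G (fst z) (fst (snd z)) (snd (snd z)))" "cf l" "cf a"
  shows "cf (\<lambda>x. fold (\<lambda>y s. G x y s) (l x) (a x))"
proof -
  let ?H = "\<lambda>x p. if fst p = [] then p else (tl (fst p), G x (hd (fst p)) (snd p))"
  have *: "(?H x ^^ k) (ys, s) = ([], fold (G x) ys s)" if "length ys \<le> k" for x k ys s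
    using that
  proof (induction k arbitrary: ys s)
    case (Suc k)
    show ?case
    proof (cases ys)
      case Nil
      then show ?thesis using Suc.IH[of "[]" s] Suc.prems by (simp del: funpow.simps add: funpow_Suc_right)
    next
      case (Cons y ys')
      then show ?thesis
        using Suc.IH[of ys' "G x y s"] Suc.prems by (simp del: funpow.simps add: funpow_Suc_right)
    qed
  qed simp
  have "cf (\<lambda>z. G (fst z) (hd (fst (snd z))) (snd (snd z)))"
    using cf_comp[OF assms(1), of "\<lambda>z. (fst z, hd (fst (snd z)), snd (snd z))"]
    by (simp add: cf_intros)
  \<comment> \<open>The code of a list bounds its length, whose own computability is derived from
    folding. Rounds after the end of the list change nothing.\<close>
  then have "cf (\<lambda>x. snd ((?H x ^^ enc (l x)) (l x, a x)))"
    by (intro cf_intros assms)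
  then show ?thesis
    by (simp add: * length_le_enc)
qed

lemma cf_rev [cf_intros]: "cf l \<Longrightarrow> cf (\<lambda>x. rev (l x))"
  unfolding rev_conv_fold by (intro cf_intros)

lemma cf_append [cf_intros]: "cf k \<Longrightarrow> cf l \<Longrightarrow> cf (\<lambda>x. k x @ l x)"
  using cf_fold[of "\<lambda>_ y s. y # s" "\<lambda>x. rev (k x)" l]
  by (simp add: cf_intros fold_Cons_rev)

lemma cf_map [cf_intros]:
  assumes "cf (\<lambda>z. F (fst z) (snd z))" "cf l"
  shows "cf (\<lambda>x. map (\<lambda>y. F x y) (l x))"
proof -
  have *: "fold (\<lambda>y s. s @ [f y]) xs ys = ys @ map f xs" for f :: "'b \<Rightarrow> 'c" and xs ys
    by (induction xs arbitrary: ys) auto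
  have "cf (\<lambda>z :: 'a \<times> 'b \<times> 'c list. F (fst z) (fst (snd z)))"
    using cf_comp[OF assms(1), of "\<lambda>z. (fst z, fst (snd z))"] by (simp add: cf_intros)
  then have "cf (\<lambda>x. fold (\<lambda>y s. s @ [F x y]) (l x) [])"
    by (intro cf_intros assms)
  then show ?thesis by (simp add: *)
qed

lemma cf_filter [cf_intros]:
  assumes "cf (\<lambda>z. P (fst z) (snd z))" "cf l"
  shows "cf (\<lambda>x. filter (\<lambda>y. P x y) (l x))"
proof -
  have *: "fold (\<lambda>y s. if p y then s @ [y] else s) xs ys = ys @ filter p xs"
    for p :: "'b \<Rightarrow> bool" and xs ys
    by (induction xs arbitrary: ys) auto
  have "cf (\<lambda>z :: 'a \<times> 'b \<times> 'b list. P (fst z) (fst (snd z)))"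
    using cf_comp[OF assms(1), of "\<lambda>z. (fst z, fst (snd z))"] by (simp add: cf_intros)
  then have "cf (\<lambda>x. fold (\<lambda>y s. if P x y then s @ [y] else s) (l x) [])"
    by (intro cf_intros assms)
  then show ?thesis by (simp add: *)
qed

lemma cf_Bex [cf_intros]:
  assumes "cf (\<lambda>z. P (fst z) (snd z))" "cf l"
  shows "cf (\<lambda>x. \<exists>y\<in>set (l x). P x y)"
proof -
  have "cf (\<lambda>x. filter (P x) (l x) \<noteq> [])"
    by (intro cf_intros assms)
  then show ?thesis by (simp add: filter_empty_conv)
qed

lemma cf_Ball [cf_intros]:
  assumes "cf (\<lambda>z. P (fst z) (snd z))" "cf l"
  shows "cf (\<lambda>x. \<forall>y\<in>set (l x). P x y)"
proof -
  have "cf (\<lambda>x. \<not> (\<exists>y\<in>set (l x). \<not> P x y))"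
    by (intro cf_intros assms)
  then show ?thesis by simp
qed

lemma cf_length [cf_intros]: "cf l \<Longrightarrow> cf (\<lambda>x. length (l x))"
proof -
  have *: "fold (\<lambda>_ s. Suc s) xs n = n + length xs" for xs :: "'b list" and n
    by (induction xs arbitrary: n) auto
  show "cf l \<Longrightarrow> ?thesis"
    using cf_fold[of "\<lambda>_ _ s. Suc s" l "\<lambda>_. 0"] by (simp add: * cf_intros)
qed

lemma cf_sum_list [cf_intros]: "cf l \<Longrightarrow> cf (\<lambda>x. sum_list (l x) :: nat)"
proof -
  have *: "sum_list xs = fold (+) xs 0" for xs :: "nat list"
    by (simp add: fold_plus_sum_list_rev)
  show "cf l \<Longrightarrow> ?thesis"
    unfolding * by (intro cf_intros)
qed

lemma cf_concat [cf_intros]: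
  assumes "cf l"
  shows "cf (\<lambda>x. concat (l x))"
proof -
  have *: "fold (\<lambda>y s. s @ y) xs ys = ys @ concat xs" for xs and ys :: "'b list"
    by (induction xs arbitrary: ys) auto
  have "cf (\<lambda>x. fold (\<lambda>y s. s @ y) (l x) [])"
    by (intro cf_intros assms)
  then show ?thesis by (simp add: *)
qed

lemma cf_upt [cf_intros]:
  assumes "cf n"
  shows "cf (\<lambda>x. [0..<n x])"
proof -
  have *: "((\<lambda>l. l @ [length l]) ^^ k) [] = [0..<k]" for k
    by (induction k) auto
  have "cf (\<lambda>x. ((\<lambda>l. l @ [length l]) ^^ n x) [])"
    by (intro cf_intros assms)
  then show ?thesis by (simp add: *)
qed

lemma cf_replicate [cf_intros]:
  assumes "cf n" "cf f"
  shows "cf (\<lambda>x. replicate (n x) (f x))"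
proof -
  have *: "((\<lambda>l. y # l) ^^ k) [] = replicate k y" for k and y :: 'b
    by (induction k) auto
  have "cf (\<lambda>x. ((\<lambda>l. f x # l) ^^ n x) [])"
    by (intro cf_intros assms cf_comp[OF assms(2)])
  then show ?thesis by (simp add: *)
qed

lemma cf_zip [cf_intros]:
  assumes "cf k" "cf l"
  shows "cf (\<lambda>x. zip (k x) (l x))"
proof -
  let ?G = "\<lambda>x s. if fst s = [] then s else (tl (fst s), snd s @ [(x, hd (fst s))])"
  have *: "snd (fold ?G xs (ys, zs)) = zs @ zip xs ys" for xs :: "'b list" and ys :: "'c list" and zs
  proof (induction xs arbitrary: ys zs)
    case (Cons x xs)
    then show ?case by (cases ys) auto
  qed simp
  have "cf (\<lambda>x. snd (fold (\<lambda>y s. ?G y s) (k x) (l x, [])))"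
    by (intro cf_intros assms)
  then show ?thesis by (simp only: *) simp
qed

lemma cf_Some [cf_intros]: "cf f \<Longrightarrow> cf (\<lambda>x. Some (f x))"
  by (rule cf_comp[of Some]) (rule cfI[OF wc_Suc], simp add: enc_option_def)

section \<open>Turing machines are simulated by computable functions\<close>

lemma cf_natD: "cf f \<Longrightarrow> wc (f :: nat \<Rightarrow> nat)"
  by (erule cfE) (metis enc_nat_def ext)

lemma cf_even [cf_intros]: "cf f \<Longrightarrow> cf (\<lambda>x. even (f x :: nat))"
proof -
  have *: "(Not ^^ n) True = even n" for n
    by (induction n) auto
  have "cf f \<Longrightarrow> cf (\<lambda>x. (Not ^^ f x) True)"
    by (intro cf_intros)
  then show "cf f \<Longrightarrow> ?thesis" by (simp only: *)
qed

lemma cf_int [cf_intros]: "cf f \<Longrightarrow> cf (\<lambda>x. int (f x))"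
proof (rule cf_comp[of int])
  have "wc (\<lambda>n. 2 * n)"
    by (rule cf_natD) (intro cf_intros)
  then show "cf int"
    by (rule cfI) (simp add: enc_int_def enc_nat_def int_encode_def sum_encode_def)
qed

lemma cf_int_succ: "cf f \<Longrightarrow> cf (\<lambda>x. f x + 1 :: int)"
proof (rule cf_comp[of "\<lambda>x. x + 1"])
  \<comment> \<open>A nonnegative x has the even code 2x, a negative x the odd code -2x - 1.
    Truncated subtraction takes the code 1 of -1 correctly to the code 0 of 0.\<close>
  have "wc (\<lambda>n. if even n then n + 2 else n - 2)"
    by (rule cf_natD) (intro cf_intros)
  then show "cf (\<lambda>x. x + 1 :: int)"
    by (rule cfI) (auto simp: enc_int_def int_encode_def sum_encode_def nat_add_distrib nat_diff_distrib)
qed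

lemma cf_int_pred: "cf f \<Longrightarrow> cf (\<lambda>x. f x - 1 :: int)"
proof (rule cf_comp[of "\<lambda>x. x - 1"])
  have "wc (\<lambda>n. if n = 0 then 1 else if even n then n - 2 else n + 2)"
    by (rule cf_natD) (intro cf_intros)
  then show "cf (\<lambda>x. x - 1 :: int)"
    by (rule cfI) (auto simp: enc_int_def int_encode_def sum_encode_def nat_add_distrib nat_diff_distrib)
qed

lemma move_eq: "move d h = (if d = MoveL then h - 1 else if d = Stay then h else h + 1)"
  by (cases d) auto

lemma cf_move [cf_intros]: "cf d \<Longrightarrow> cf h \<Longrightarrow> cf (\<lambda>x. move (d x) (h x))"
  unfolding move_eq by (intro cf_intros cf_int_pred cf_int_succ)

text \<open>The contents of a tape are represented by the list of all writes, the latest one last.\<close>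

definition look :: "(int \<times> sym) list \<Rightarrow> int \<Rightarrow> sym" where
  "look al h = fold (\<lambda>e a. if fst e = h then snd e else a) al Blank"

lemma look_Nil: "look [] = (\<lambda>_. Blank)"
  by (simp add: look_def fun_eq_iff)

lemma look_snoc: "look (al @ [(h, s)]) = (look al)(h := s)"
  by (auto simp: look_def fun_eq_iff)

lemma cf_look [cf_intros]: "cf al \<Longrightarrow> cf h \<Longrightarrow> cf (\<lambda>x. look (al x) (h x))"
  by (rule cf_comp2[of look]) (unfold look_def, intro cf_intros)

lemma look_eq_Blank: "h \<notin> fst ` set al \<Longrightarrow> look al h = Blank"
  by (induction al rule: rev_induct) (auto simp: look_Nil look_def)

type_synonym ltape = "(int \<times> sym) list \<times> int"
type_synonym lconf = "nat \<times> ltape list"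

definition tape_of :: "ltape \<Rightarrow> tape" where
  "tape_of t = (look (fst t), snd t)"

definition conf_of :: "lconf \<Rightarrow> conf" where
  "conf_of c = (fst c, map tape_of (snd c))"

definition lscan :: "ltape \<Rightarrow> sym" where
  "lscan t = look (fst t) (snd t)"

definition lact :: "ltape \<Rightarrow> sym \<times> dir \<Rightarrow> ltape" where
  "lact t a = (fst t @ [(snd t, fst a)], move (snd a) (snd t))"

definition lookup :: "((nat \<times> sym list) \<times> nat \<times> (sym \<times> dir) list) list \<Rightarrow> lconf \<Rightarrow>
    ((nat \<times> sym list) \<times> nat \<times> (sym \<times> dir) list) list" where
  "lookup tbl c = filter (\<lambda>e. fst e = (fst c, map lscan (snd c))) tbl"

definition lstep :: "((nat \<times> sym list) \<times> nat \<times> (sym \<times> dir) list) list \<Rightarrow> lconf \<Rightarrow> lconf" where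
  "lstep tbl c = (if lookup tbl c = [] then c else
     (fst (snd (hd (lookup tbl c))),
      map (\<lambda>z. lact (fst z) (snd z)) (zip (snd c) (snd (snd (hd (lookup tbl c)))))))"

definition linit :: "nat \<Rightarrow> bool list \<Rightarrow> lconf" where
  "linit k w = (0, (map (\<lambda>z. (int (fst z), if snd z then Bit True else Bit False)) (zip [0..<length w] w), 0) #
     replicate (k - 1) ([], 0))"

text \<open>A bounded form of the \<open>LEAST\<close> in \<open>tape_output\<close>: a position
  belongs to the output if all cells up to it are bits, and the number of writes bounds the
  positions to be tried.\<close>

definition lout :: "ltape \<Rightarrow> bool list" where
  "lout t = map (\<lambda>i. look (fst t) (int i) = Bit True)
     (filter (\<lambda>i. \<forall>j\<in>set [0..<Suc i]. look (fst t) (int j) = Bit True \<or> look (fst t) (int j) = Bit False)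
       [0..<length (fst t)])"

lemma cf_lookup [cf_intros]: "cf f \<Longrightarrow> cf (\<lambda>x. lookup tbl (f x))"
  by (rule cf_comp[of "lookup tbl"]) (unfold lookup_def lscan_def, intro cf_intros)

lemma cf_lstep [cf_intros]: "cf f \<Longrightarrow> cf (\<lambda>x. lstep tbl (f x))"
  unfolding lstep_def lact_def by (intro cf_intros)

lemma cf_linit [cf_intros]: "cf f \<Longrightarrow> cf (\<lambda>x. linit k (f x))"
  unfolding linit_def by (intro cf_intros)

lemma cf_lout [cf_intros]: "cf f \<Longrightarrow> cf (\<lambda>x. lout (f x))"
  by (rule cf_comp[of lout]) (unfold lout_def, intro cf_intros)

lemma scanned_tape_of: "scanned (tape_of t) = lscan t"
  by (simp add: tape_of_def lscan_def)

lemma tape_of_lact: "tape_of (lact t a) = act (tape_of t) a"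
  by (cases a) (simp add: tape_of_def lact_def look_snoc)

text \<open>A finite transition function is a constant list, which a program can contain.\<close>

definition table :: "tm \<Rightarrow> ((nat \<times> sym list) \<times> nat \<times> (sym \<times> dir) list) list" where
  "table M = (SOME tbl. \<forall>k v. (k, v) \<in> set tbl \<longleftrightarrow> delta M k = Some v)"

lemma in_table:
  assumes "is_tm M"
  shows "(k, v) \<in> set (table M) \<longleftrightarrow> delta M k = Some v"
proof -
  have "finite ((\<lambda>k. (k, the (delta M k))) ` dom (delta M))"
    using assms by (auto simp: is_tm_def)
  from finite_list[OF this] obtain tbl
    where tbl: "set tbl = (\<lambda>k. (k, the (delta M k))) ` dom (delta M)" ..
  have "(k, v) \<in> set tbl \<longleftrightarrow> delta M k = Some v" for k v
    unfolding tbl by (cases "delta M k") (auto simp: image_iff)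
  then have "\<exists>tbl. \<forall>k v. (k, v) \<in> set tbl \<longleftrightarrow> delta M k = Some v"
    by blast
  from someI_ex[OF this] have "\<forall>k v. (k, v) \<in> set (table M) \<longleftrightarrow> delta M k = Some v"
    unfolding table_def .
  then show ?thesis by blast
qed

lemma lookup_Nil:
  assumes "is_tm M"
  shows "lookup (table M) c = [] \<longleftrightarrow> halted M (conf_of c)"
proof -
  have "lookup (table M) c = [] \<longleftrightarrow> (\<forall>v. ((fst c, map lscan (snd c)), v) \<notin> set (table M))"
    by (auto simp: lookup_def filter_empty_conv)
  also have "\<dots> \<longleftrightarrow> halted M (conf_of c)"
    by (cases "delta M (fst c, map lscan (snd c))")
      (auto simp: in_table[OF assms] conf_of_def scanned_tape_of o_def)
  finally show ?thesis .
qed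

lemma conf_of_lstep:
  assumes "is_tm M"
  shows "conf_of (lstep (table M) c) = step M (conf_of c)"
proof (cases "lookup (table M) c = []")
  case True
  then have "halted M (conf_of c)" by (simp add: lookup_Nil[OF assms])
  then show ?thesis by (simp add: lstep_def True conf_of_def)
next
  case False
  let ?e = "hd (lookup (table M) c)"
  have "?e \<in> set (lookup (table M) c)" using False by simp
  then have "?e \<in> set (table M)" "fst ?e = (fst c, map lscan (snd c))"
    by (auto simp: lookup_def)
  then have "delta M (fst c, map lscan (snd c)) = Some (snd ?e)"
    by (metis in_table[OF assms] prod.collapse)
  then show ?thesis
    using False
    by (cases "snd ?e")
      (simp add: lstep_def conf_of_def scanned_tape_of o_def tape_of_lact map2_map_map zip_map1 split_beta)
qed

lemma tape_of_input:
  "tape_of (map (\<lambda>z. (int (fst z), if snd z then Bit True else Bit False)) (zip [0..<length w] w), 0) =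
    input_tape w"
proof (induction w rule: rev_induct)
  case Nil
  show ?case by (simp add: tape_of_def input_tape_def look_Nil fun_eq_iff)
next
  case (snoc b w)
  have bit: "(if b then Bit True else Bit False) = Bit b" for b
    by simp
  from snoc show ?case
    by (auto simp: tape_of_def input_tape_def look_snoc fun_eq_iff bit nth_append)
qed

lemma conf_of_linit: "conf_of (linit (tapes M) w) = init_conf M w"
  using tape_of_input[of w] tape_of_input[of "[]"]
  by (simp add: conf_of_def linit_def init_conf_def)

lemma conf_of_lrun:
  assumes "is_tm M"
  shows "conf_of ((lstep (table M) ^^ T) (linit (tapes M) w)) = run M w T"
  by (induction T) (simp_all add: run_def conf_of_linit conf_of_lstep[OF assms])

lemma length_step:
  assumes "is_tm M" "length (snd c) = tapes M"
  shows "length (snd (step M c)) = tapes M"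
  using assms by (cases c) (auto simp: is_tm_def split: option.split)

lemma length_run:
  assumes "is_tm M"
  shows "length (snd (run M w T)) = tapes M"
proof (induction T)
  case 0
  show ?case using assms by (simp add: run_def init_conf_def is_tm_def)
next
  case (Suc T)
  then show ?case using length_step[OF assms] by (simp add: run_def)
qed

lemma tape_output_tape_of: "tape_output (tape_of t) = lout t"
proof -
  let ?bit = "\<lambda>i. look (fst t) (int i) \<in> range Bit"
  define m where "m = (LEAST i. \<not> ?bit i)"
  \<comment> \<open>Pigeonhole: the writes reach at most \<open>length (fst t)\<close> different
    cells, so one of the cells 0, ..., \<open>length (fst t)\<close> is still blank.\<close>
  have "\<exists>i\<le>length (fst t). \<not> ?bit i"
  proof -
    have "card (fst ` set (fst t)) \<le> length (fst t)"
      by (meson card_image_le card_length finite_set le_trans)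
    moreover have "card (int ` {..length (fst t)}) = Suc (length (fst t))"
      by (simp add: card_image)
    ultimately have "\<not> int ` {..length (fst t)} \<subseteq> fst ` set (fst t)"
      using card_mono[of "fst ` set (fst t)" "int ` {..length (fst t)}"] by auto
    then show ?thesis
      using look_eq_Blank by fastforce
  qed
  then obtain i where i: "i \<le> length (fst t)" "\<not> ?bit i" by blast
  have "\<not> ?bit m" unfolding m_def by (rule LeastI) (rule i(2))
  moreover have "?bit j" if "j < m" for j
    using not_less_Least[of j "\<lambda>i. \<not> ?bit i"] that by (auto simp: m_def)
  ultimately have *: "(\<forall>j\<in>set [0..<Suc i]. ?bit j) \<longleftrightarrow> i < m" for i
    by (metis atLeastLessThan_iff atLeast_upt less_Suc_eq_le less_le_trans linorder_not_less lessThan_iff)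
  have "m \<le> i" unfolding m_def by (rule Least_le) (rule i(2))
  then have le: "m \<le> length (fst t)" using i by simp
  have filter: "filter (\<lambda>i. i < m) [0..<n] = [0..<m]" if "m \<le> n" for n
    using that by (induction n rule: dec_induct) auto
  have bit: "s \<in> range Bit \<longleftrightarrow> s = Bit True \<or> s = Bit False" for s
    by (auto simp: image_iff)
  show ?thesis
    using filter[OF le] * unfolding lout_def tape_of_def
    by (simp add: bit m_def[unfolded bit])
qed

lemma cf_last: "cf l \<Longrightarrow> cf (\<lambda>x. last (l x))"
  unfolding hd_rev[symmetric] by (intro cf_intros)

lemma cf_halted [cf_intros]:
  assumes "is_tm M" "cf w" "cf T"
  shows "cf (\<lambda>x. halted M (run M (w x) (T x)))"
  unfolding conf_of_lrun[OF assms(1), symmetric] lookup_Nil[OF assms(1), symmetric]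
  by (intro cf_intros assms)

lemma cf_conf_output [cf_intros]:
  assumes "is_tm M" "cf w" "cf T"
  shows "cf (\<lambda>x. conf_output (run M (w x) (T x)))"
proof -
  have "conf_output (run M w T) = lout (last (snd ((lstep (table M) ^^ T) (linit (tapes M) w))))" for w T
  proof -
    have "length (snd (conf_of ((lstep (table M) ^^ T) (linit (tapes M) w)))) \<ge> 1"
      using length_run[OF assms(1), of w T] assms(1)
      unfolding conf_of_lrun[OF assms(1)] by (simp add: is_tm_def)
    then have "snd ((lstep (table M) ^^ T) (linit (tapes M) w)) \<noteq> []"
      by (auto simp: conf_of_def)
    then show ?thesis
      unfolding conf_of_lrun[OF assms(1), symmetric]
      by (simp add: conf_output_def conf_of_def last_map tape_output_tape_of)
  qed
  then show ?thesis
    by (simp only:) (intro cf_intros cf_last assms)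
qed

lemma cf_computes_within [cf_intros]:
  "is_tm M \<Longrightarrow> cf w \<Longrightarrow> cf T \<Longrightarrow> cf y \<Longrightarrow> cf (\<lambda>x. computes_within M (w x) (T x) (y x))"
  unfolding computes_within_def by (intro cf_intros)

lemma run_halted:
  assumes "halted M (run M w T)" "T \<le> T'"
  shows "run M w T' = run M w T"
  using assms(2)
proof (induction T' rule: dec_induct)
  case (step n)
  have "step M (run M w T) = run M w T"
    using assms(1) by (cases "run M w T") simp
  with step show ?case by (simp add: run_def)
qed simp

lemma computes_within_mono:
  "computes_within M w T x \<Longrightarrow> T \<le> T' \<Longrightarrow> computes_within M w T' x"
  unfolding computes_within_def by (metis run_halted)

lemma computes_within_unique:
  "computes_within M w T x \<Longrightarrow> computes_within M w T' y \<Longrightarrow> x = y"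
  unfolding computes_within_def by (metis run_halted nat_le_linear)

lemma computes_unique: "computes M w x \<Longrightarrow> computes M w y \<Longrightarrow> x = y"
  unfolding computes_def by (metis computes_within_unique)

text \<open>Simulate the machine up to its first halting time and measure the unary output.\<close>

lemma recursive_fun_imp_cf:
  assumes "recursive_fun t"
  shows "cf t"
proof -
  obtain M where M: "is_tm M" "\<And>n. computes M (replicate n True) (replicate (t n) True)"
    using assms by (auto simp: recursive_fun_def)
  let ?T = "\<lambda>n. LEAST T. halted M (run M (replicate n True) T)"
  have ex: "\<exists>T. halted M (run M (replicate n True) T)" for n
    using M(2)[of n] by (auto simp: computes_def computes_within_def)
  have "length (conf_output (run M (replicate n True) (?T n))) = t n" for n
  proof -
    have "computes_within M (replicate n True) (?T n) (conf_output (run M (replicate n True) (?T n)))"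
      using LeastI_ex[OF ex[of n]] by (simp add: computes_within_def)
    then have "conf_output (run M (replicate n True) (?T n)) = replicate (t n) True"
      using M(2)[of n] computes_unique computes_def by metis
    then show ?thesis by simp
  qed
  moreover have "cf (\<lambda>n. length (conf_output (run M (replicate n True) (?T n))))"
    by (intro cf_intros cf_Least M(1) ex)
  ultimately show ?thesis by simp
qed

text \<open>The running time on any one input of length n, here the unary one, can be found by
  search. This makes a time-constructible bound available as a recursive bound.\<close>

lemma runtime_is_imp_cf:
  assumes "is_tm M" "\<And>w. runtime_is M w (t (length w))"
  shows "cf t"
proof -
  have rt: "halted M (run M (replicate n True) (t n))"
    "\<And>T'. T' < t n \<Longrightarrow> \<not> halted M (run M (replicate n True) T')" for n
    using assms(2)[of "replicate n True"] by (auto simp: runtime_is_def)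
  have "(LEAST T. halted M (run M (replicate n True) T)) = t n" for n
    by (rule Least_equality) (use rt linorder_not_less in blast)+
  moreover have "cf (\<lambda>n. LEAST T. halted M (run M (replicate n True) T))"
    using rt(1) by (intro cf_Least cf_intros assms(1)) auto
  ultimately show ?thesis by simp
qed

section \<open>Computable functions are computed by Turing machines\<close>

datatype instr = IInc nat | IDec nat | IRead nat nat | IOut bool | IJz nat nat | IJmp nat

type_synonym iconf = "nat \<times> store \<times> bool list \<times> bool list"

fun istep :: "instr list \<Rightarrow> iconf \<Rightarrow> iconf" where
  "istep P (pc, s, i, out) = (if pc < length P then
     (case P ! pc of
        IInc v \<Rightarrow> (Suc pc, s(v := Suc (s v)), i, out)
      | IDec v \<Rightarrow> (Suc pc, s(v := s v - 1), i, out)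
      | IRead v w \<Rightarrow> (Suc pc, (case i of [] \<Rightarrow> s
          | b # _ \<Rightarrow> if b then s(v := Suc (s v)) else s(w := Suc (s w))), tl i, out)
      | IOut b \<Rightarrow> (Suc pc, s, i, out @ [b])
      | IJz v l \<Rightarrow> (if s v = 0 then l else Suc pc, s, i, out)
      | IJmp l \<Rightarrow> (l, s, i, out))
     else (pc, s, i, out))"

primrec csize :: "com \<Rightarrow> nat" where
  "csize (Inc v) = 1"
| "csize (Dec v) = 1"
| "csize (Read v w) = 1"
| "csize (Out b) = 1"
| "csize (c1 ;; c2) = csize c1 + csize c2"
| "csize (Cond v c1 c2) = csize c1 + csize c2 + 2"
| "csize (While v c) = csize c + 2"

text \<open>Jump targets are absolute, so the address \<open>n\<close> of the first instruction is a
  parameter.\<close>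

primrec compile :: "nat \<Rightarrow> com \<Rightarrow> instr list" where
  "compile n (Inc v) = [IInc v]"
| "compile n (Dec v) = [IDec v]"
| "compile n (Read v w) = [IRead v w]"
| "compile n (Out b) = [IOut b]"
| "compile n (c1 ;; c2) = compile n c1 @ compile (n + csize c1) c2"
| "compile n (Cond v c1 c2) =
     IJz v (n + csize c1 + 2) # compile (n + 1) c1 @
     IJmp (n + csize c1 + csize c2 + 2) # compile (n + csize c1 + 2) c2"
| "compile n (While v c) = IJz v (n + csize c + 2) # compile (n + 1) c @ [IJmp n]"

lemma length_compile [simp]: "length (compile n c) = csize c"
  by (induction c arbitrary: n) auto

definition reaches :: "instr list \<Rightarrow> iconf \<Rightarrow> iconf \<Rightarrow> bool" where
  "reaches P a b \<longleftrightarrow> (\<exists>k. (istep P ^^ k) a = b)"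

lemma reaches_refl: "reaches P a a"
  unfolding reaches_def by (rule exI[of _ 0]) simp

lemma reaches_step: "istep P a = b \<Longrightarrow> reaches P b c \<Longrightarrow> reaches P a c"
  unfolding reaches_def by (metis comp_apply funpow_Suc_right)

lemma reaches_trans: "reaches P a b \<Longrightarrow> reaches P b c \<Longrightarrow> reaches P a c"
  unfolding reaches_def by (metis comp_apply funpow_add)

text \<open>Induction on the execution. The surrounding code \<open>xs\<close> and \<open>ys\<close>
  is arbitrary, because each subprogram sits in the midst of the code of its parent; a further round
  of a loop runs the same code again.\<close>

lemma reaches_compile:
  assumes "exec c \<sigma> \<sigma>'" "P = xs @ compile (length xs) c @ ys"
  shows "reaches P (length xs, \<sigma>) (length xs + csize c, \<sigma>')"
  using assms
proof (induction arbitrary: xs ys)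
  case (exec_Seq c1 \<sigma> \<sigma>' c2 \<sigma>'')
  have "reaches P (length xs, \<sigma>) (length xs + csize c1, \<sigma>')"
    by (rule exec_Seq.IH(1)) (use exec_Seq.prems in simp)
  moreover have "reaches P (length (xs @ compile (length xs) c1), \<sigma>')
      (length (xs @ compile (length xs) c1) + csize c2, \<sigma>'')"
    by (rule exec_Seq.IH(2)) (use exec_Seq.prems in simp)
  ultimately show ?case
    by (simp add: add.assoc) (rule reaches_trans)
next
  case (exec_Cond_pos \<sigma> v c1 \<sigma>' c2)
  obtain s i out where \<sigma>: "\<sigma> = (s, i, out)" by (cases \<sigma>)
  let ?xs = "xs @ [IJz v (length xs + csize c1 + 2)]"
  have "istep P (length xs, \<sigma>) = (length ?xs, \<sigma>)"
    using exec_Cond_pos by (simp add: \<sigma>)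
  moreover have "reaches P (length ?xs, \<sigma>) (length ?xs + csize c1, \<sigma>')"
    by (rule exec_Cond_pos.IH) (use exec_Cond_pos.prems in simp)
  moreover have "istep P (length ?xs + csize c1, \<sigma>') = (length xs + csize (Cond v c1 c2), \<sigma>')"
    using exec_Cond_pos.prems by (cases \<sigma>') (simp add: nth_append)
  ultimately show ?case
    by (metis reaches_refl reaches_step reaches_trans)
next
  case (exec_Cond_zero \<sigma> v c2 \<sigma>' c1)
  obtain s i out where \<sigma>: "\<sigma> = (s, i, out)" by (cases \<sigma>)
  let ?xs = "xs @ IJz v (length xs + csize c1 + 2) # compile (length xs + 1) c1 @
     [IJmp (length xs + csize c1 + csize c2 + 2)]"
  have "istep P (length xs, \<sigma>) = (length ?xs, \<sigma>)"
    using exec_Cond_zero by (simp add: \<sigma>)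
  moreover have "reaches P (length ?xs, \<sigma>) (length ?xs + csize c2, \<sigma>')"
    by (rule exec_Cond_zero.IH) (use exec_Cond_zero.prems in \<open>simp add: add.commute\<close>)
  moreover have "length ?xs + csize c2 = length xs + csize (Cond v c1 c2)"
    by simp
  ultimately show ?case
    by (metis reaches_step)
next
  case (exec_While_zero \<sigma> v c)
  then have "istep P (length xs, \<sigma>) = (length xs + csize (While v c), \<sigma>)"
    by (cases \<sigma>) simp
  then show ?case
    by (metis reaches_refl reaches_step)
next
  case (exec_While_pos \<sigma> v c \<sigma>' \<sigma>'')
  obtain s i out where \<sigma>: "\<sigma> = (s, i, out)" by (cases \<sigma>)
  let ?xs = "xs @ [IJz v (length xs + csize c + 2)]"
  have 1: "istep P (length xs, \<sigma>) = (length ?xs, \<sigma>)"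
    using exec_While_pos by (simp add: \<sigma>)
  have 2: "reaches P (length ?xs, \<sigma>) (length ?xs + csize c, \<sigma>')"
    by (rule exec_While_pos.IH(1)) (use exec_While_pos.prems in simp)
  have 3: "istep P (length ?xs + csize c, \<sigma>') = (length xs, \<sigma>')"
    using exec_While_pos.prems by (cases \<sigma>') (simp add: nth_append)
  have 4: "reaches P (length xs, \<sigma>') (length xs + csize (While v c), \<sigma>'')"
    by (rule exec_While_pos.IH(2)) (rule exec_While_pos.prems)
  show ?case
    by (rule reaches_step[OF 1 reaches_trans[OF 2 reaches_step[OF 3 4]]])
next
  case (exec_Inc v s i out)
  then show ?case by (intro reaches_step[OF _ reaches_refl]) simp
next
  case (exec_Dec v s i out)
  then show ?case by (intro reaches_step[OF _ reaches_refl]) simp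
next
  case (exec_Read_True v w s i out)
  then show ?case by (intro reaches_step[OF _ reaches_refl]) simp
next
  case (exec_Read_False v w s i out)
  then show ?case by (intro reaches_step[OF _ reaches_refl]) simp
next
  case (exec_Read_end v w s out)
  then show ?case by (intro reaches_step[OF _ reaches_refl]) simp
next
  case (exec_Out b s i out)
  then show ?case by (intro reaches_step[OF _ reaches_refl]) simp
qed

subsection \<open>Running instructions on a Turing machine\<close>

text \<open>
  Tape 0 holds the input, tape \<open>Suc v\<close> (for \<open>v < k\<close>) the counter \<open>v\<close> as the distance of its head
  from a mark in cell 0, and tape \<open>Suc k\<close> the output. State 0 sets the marks; the instruction
  number \<open>pc\<close> is executed in state \<open>Suc pc\<close>.
\<close>

fun ivars :: "instr \<Rightarrow> nat set" where
  "ivars (IInc v) = {v}"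
| "ivars (IDec v) = {v}"
| "ivars (IRead v w) = {v, w}"
| "ivars (IOut b) = {}"
| "ivars (IJz v l) = {v}"
| "ivars (IJmp l) = {}"

fun write_sym :: "nat \<Rightarrow> instr \<Rightarrow> sym list \<Rightarrow> nat \<Rightarrow> sym" where
  "write_sym k (IOut b) ss j = (if j = Suc k then Bit b else ss ! j)"
| "write_sym k _ ss j = ss ! j"

fun move_dir :: "nat \<Rightarrow> instr \<Rightarrow> sym list \<Rightarrow> nat \<Rightarrow> dir" where
  "move_dir k (IInc v) ss j = (if j = Suc v then MoveR else Stay)"
| "move_dir k (IDec v) ss j = (if j = Suc v \<and> ss ! j \<noteq> Mark 0 then MoveL else Stay)"
| "move_dir k (IRead v w) ss j =
     (if j = 0 \<and> ss ! 0 \<noteq> Blank \<or> ss ! 0 = Bit True \<and> j = Suc v \<or> ss ! 0 = Bit False \<and> j = Suc w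
      then MoveR else Stay)"
| "move_dir k (IOut b) ss j = (if j = Suc k then MoveR else Stay)"
| "move_dir k _ ss j = Stay"

fun next_pc :: "instr \<Rightarrow> sym list \<Rightarrow> nat \<Rightarrow> nat" where
  "next_pc (IJz v l) ss pc = (if ss ! Suc v = Mark 0 then l else Suc pc)"
| "next_pc (IJmp l) ss pc = l"
| "next_pc _ ss pc = Suc pc"

definition symbols :: "sym set" where
  "symbols = {Blank, Bit True, Bit False, Mark 0}"

text \<open>Restricting the table to \<open>symbols\<close> and to states up to
  \<open>length P\<close> makes it finite. A program counter at or past the end of the code becomes
  a state above \<open>length P\<close>, without transitions, and so halts.\<close>

definition mach :: "nat \<Rightarrow> instr list \<Rightarrow> tm" where
  "mach k P = \<lparr>tapes = k + 2, delta = (\<lambda>(q, ss).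
     if length ss = k + 2 \<and> set ss \<subseteq> symbols \<and> q \<le> length P then
       Some (if q = 0 then (1, map (\<lambda>j. (if 1 \<le> j \<and> j \<le> k then Mark 0 else ss ! j, Stay)) [0..<k + 2])
         else (Suc (next_pc (P ! (q - 1)) ss (q - 1)),
           map (\<lambda>j. (write_sym k (P ! (q - 1)) ss j, move_dir k (P ! (q - 1)) ss j)) [0..<k + 2]))
     else None)\<rparr>"

lemma tapes_mach: "tapes (mach k P) = k + 2"
  by (simp add: mach_def)

lemma is_tm_mach: "is_tm (mach k P)"
proof -
  have "dom (delta (mach k P)) \<subseteq> {..length P} \<times> {ss. set ss \<subseteq> symbols \<and> length ss = k + 2}"
    by (auto simp: mach_def split: if_splits)
  moreover have "finite symbols"
    by (simp add: symbols_def)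
  ultimately have "finite (dom (delta (mach k P)))"
    using finite_lists_length_eq[of symbols "k + 2"] finite_subset by blast
  then show ?thesis
    by (auto simp: is_tm_def mach_def split: if_splits)
qed

fun itape :: "nat \<Rightarrow> bool list \<Rightarrow> store \<times> bool list \<times> bool list \<Rightarrow> nat \<Rightarrow> tape" where
  "itape k w (s, i, out) j =
     (if j = 0 then (fst (input_tape w), int (length w) - int (length i))
      else if j = Suc k then (fst (input_tape out), int (length out))
      else ((\<lambda>x. if x = 0 then Mark 0 else Blank), int (s (j - 1))))"

declare itape.simps [simp del]

definition tm_conf :: "nat \<Rightarrow> bool list \<Rightarrow> iconf \<Rightarrow> conf" where
  "tm_conf k w c = (Suc (fst c), map (itape k w (snd c)) [0..<k + 2])"

lemma scanned_itape_0:
  "suffix i w \<Longrightarrow> scanned (itape k w (s, i, out) 0) = (case i of [] \<Rightarrow> Blank | b # _ \<Rightarrow> Bit b)"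
  by (auto simp: itape.simps input_tape_def suffix_def nth_append split: list.split)

lemma scanned_itape_counter:
  "v < k \<Longrightarrow> scanned (itape k w (s, i, out) (Suc v)) = (if s v = 0 then Mark 0 else Blank)"
  by (simp add: itape.simps)

lemma scanned_itape_out: "scanned (itape k w (s, i, out) (Suc k)) = Blank"
  by (simp add: itape.simps input_tape_def)

lemma input_tape_snoc: "(fst (input_tape out))(int (length out) := Bit b) = fst (input_tape (out @ [b]))"
  by (auto simp: input_tape_def fun_eq_iff nth_append)

lemma delta_tm_conf:
  assumes "suffix i w" "pc < length P"
  shows "delta (mach k P) (Suc pc, map (scanned \<circ> itape k w (s, i, out)) [0..<k + 2]) =
    Some (let ss = map (scanned \<circ> itape k w (s, i, out)) [0..<k + 2] in
      (Suc (next_pc (P ! pc) ss pc),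
       map (\<lambda>j. (write_sym k (P ! pc) ss j, move_dir k (P ! pc) ss j)) [0..<k + 2]))"
proof -
  have "scanned (itape k w (s, i, out) j) \<in> symbols" if j: "j < k + 2" for j
  proof -
    consider "j = 0" | "j = Suc k" | v where "v < k" "j = Suc v"
      using j by (cases j) (auto simp: less_Suc_eq)
    then show ?thesis
    proof cases
      case 1
      then show ?thesis
        using scanned_itape_0[OF assms(1), of k s out] by (auto simp: symbols_def split: list.split)
    next
      case 2
      then show ?thesis using scanned_itape_out by (auto simp: symbols_def)
    next
      case (3 v)
      then show ?thesis using scanned_itape_counter by (auto simp: symbols_def)
    qed
  qed
  then have "set (map (scanned \<circ> itape k w (s, i, out)) [0..<k + 2]) \<subseteq> symbols"
    by (auto simp del: upt_Suc)
  then show ?thesis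
    using assms(2) by (simp add: mach_def Let_def del: upt_Suc)
qed

lemma act_itape:
  assumes "suffix i w" "pc < length P" "ivars (P ! pc) \<subseteq> {..<k}" "j < k + 2"
    and ss: "ss = map (scanned \<circ> itape k w (s, i, out)) [0..<k + 2]"
  shows "act (itape k w (s, i, out) j) (write_sym k (P ! pc) ss j, move_dir k (P ! pc) ss j) =
    itape k w (snd (istep P (pc, s, i, out))) j"
proof -
  have nth: "ss ! j = scanned (itape k w (s, i, out) j)" if "j < k + 2" for j
    using that by (simp add: ss del: upt_Suc)
  have ss0: "ss ! 0 = (case i of [] \<Rightarrow> Blank | b # _ \<Rightarrow> Bit b)"
    using nth[of 0] scanned_itape_0[OF assms(1)] by simp
  consider "j = 0" | "j = Suc k" | v where "v < k" "j = Suc v"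
    using assms(4) by (cases j) (auto simp: less_Suc_eq)
  then show ?thesis
  proof cases
    case 1
    have "length i \<le> length w" using assms(1) by (simp add: suffix_length_le)
    with 1 show ?thesis
      using assms(2) nth[of 0] ss0 by (cases "P ! pc"; cases i) (auto simp: itape.simps)
  next
    case 2
    then show ?thesis
      using assms(2,3) nth[of "Suc k"] by (cases "P ! pc") (auto simp: itape.simps input_tape_snoc)
  next
    case (3 v)
    then show ?thesis
      using assms(2,3) nth[of "Suc v"] ss0 by (cases "P ! pc") (auto simp: itape.simps split: list.split)
  qed
qed

lemma next_pc_eq:
  assumes "pc < length P" "ivars (P ! pc) \<subseteq> {..<k}"
  shows "next_pc (P ! pc) (map (scanned \<circ> itape k w (s, i, out)) [0..<k + 2]) pc =
    fst (istep P (pc, s, i, out))"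
  using assms by (cases "P ! pc") (auto simp: scanned_itape_counter simp del: upt_Suc)

lemma map2_map_same: "map2 f (map g xs) (map h xs) = map (\<lambda>x. f (g x) (h x)) xs"
  by (induction xs) auto

text \<open>One instruction costs exactly one machine step, so exact running times can be read off
  from the instruction list; time-constructibility requires this.\<close>

lemma step_tm_conf:
  assumes "suffix (fst (snd (snd c))) w" "\<forall>I\<in>set P. ivars I \<subseteq> {..<k}"
  shows "step (mach k P) (tm_conf k w c) = tm_conf k w (istep P c)"
proof -
  obtain pc s i out where c: "c = (pc, s, i, out)" by (cases c)
  show ?thesis
  proof (cases "pc < length P")
    case True
    let ?ss = "map (scanned \<circ> itape k w (s, i, out)) [0..<k + 2]"
    have vars: "ivars (P ! pc) \<subseteq> {..<k}" using assms(2) True by simp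
    have suf: "suffix i w" using assms(1) by (simp add: c)
    have "step (mach k P) (tm_conf k w c) =
      (Suc (next_pc (P ! pc) ?ss pc), map (\<lambda>j. act (itape k w (s, i, out) j)
        (write_sym k (P ! pc) ?ss j, move_dir k (P ! pc) ?ss j)) [0..<k + 2])"
      by (simp only: tm_conf_def step.simps c fst_conv snd_conv map_map delta_tm_conf[OF suf True]
        Let_def option.case prod.case map2_map_same)
    also have "\<dots> = tm_conf k w (istep P c)"
      unfolding tm_conf_def prod.inject next_pc_eq[OF True vars] c
      using act_itape[OF suf True vars _ refl] by (simp del: upt_Suc istep.simps)
    finally show ?thesis .
  next
    case False
    then show ?thesis by (simp add: c tm_conf_def mach_def del: upt_Suc)
  qed
qed

lemma halted_tm_conf:
  assumes "suffix (fst (snd (snd c))) w"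
  shows "halted (mach k P) (tm_conf k w c) \<longleftrightarrow> length P \<le> fst c"
proof -
  obtain pc s i out where c: "c = (pc, s, i, out)" by (cases c)
  show ?thesis
  proof (cases "pc < length P")
    case True
    have "suffix i w" using assms by (simp add: c)
    from delta_tm_conf[OF this True] True show ?thesis
      by (simp only: tm_conf_def halted.simps c fst_conv snd_conv map_map) simp
  next
    case False
    then show ?thesis by (simp add: c tm_conf_def mach_def del: upt_Suc)
  qed
qed

lemma suffix_istep:
  assumes "suffix (fst (snd (snd c))) w"
  shows "suffix (fst (snd (snd ((istep P ^^ T) c)))) w"
proof (induction T)
  case (Suc T)
  obtain pc s i out where c: "(istep P ^^ T) c = (pc, s, i, out)" by (cases "(istep P ^^ T) c")
  have "suffix i w" using Suc by (simp add: c)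
  then have "suffix (tl i) w" by (metis suffix_order.trans suffix_tl)
  then show ?case
    using \<open>suffix i w\<close> by (simp add: c split: instr.split)
qed (use assms in simp)

definition iinit :: "bool list \<Rightarrow> iconf" where
  "iinit w = (0, (\<lambda>_. 0), w, [])"

lemma step_init_conf: "step (mach k P) (init_conf (mach k P) w) = tm_conf k w (iinit w)"
proof -
  let ?t = "\<lambda>j. if j = 0 then input_tape w else input_tape []"
  have tapes: "input_tape w # replicate (tapes (mach k P) - 1) (input_tape []) = map ?t [0..<k + 2]"
    by (rule nth_equalityI) (auto simp: tapes_mach nth_Cons split: nat.split simp del: upt_Suc)
  let ?ss = "map (scanned \<circ> ?t) [0..<k + 2]"
  have "scanned (?t j) \<in> symbols" for j
    by (auto simp: symbols_def input_tape_def)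
  then have "set ?ss \<subseteq> symbols"
    unfolding set_map o_def by blast
  then have "delta (mach k P) (0, ?ss) = Some (1, map (\<lambda>j. (if 1 \<le> j \<and> j \<le> k then Mark 0 else ?ss ! j, Stay)) [0..<k + 2])"
    by (simp add: mach_def del: upt_Suc)
  then have "step (mach k P) (init_conf (mach k P) w) = (1, map (\<lambda>j. act (?t j)
      (if 1 \<le> j \<and> j \<le> k then Mark 0 else ?ss ! j, Stay)) [0..<k + 2])"
    by (simp only: init_conf_def tapes step.simps map_map option.case prod.case map2_map_same)
  also have "\<dots> = tm_conf k w (iinit w)"
    by (auto simp: itape.simps tm_conf_def iinit_def input_tape_def fun_eq_iff simp del: upt_Suc)
  finally show ?thesis .
qed

lemma run_mach_Suc:
  assumes "\<forall>I\<in>set P. ivars I \<subseteq> {..<k}"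
  shows "run (mach k P) w (Suc T) = tm_conf k w ((istep P ^^ T) (iinit w))"
proof (induction T)
  case 0
  show ?case by (simp add: run_def step_init_conf)
next
  case (Suc T)
  have "run (mach k P) w (Suc (Suc T)) = step (mach k P) (run (mach k P) w (Suc T))"
    by (simp add: run_def)
  also have "\<dots> = tm_conf k w ((istep P ^^ Suc T) (iinit w))"
    unfolding Suc using assms by (subst step_tm_conf) (auto intro!: suffix_istep simp: iinit_def)
  finally show ?case .
qed

lemma halted_mach_0: "\<not> halted (mach k P) (run (mach k P) w 0)"
proof
  assume "halted (mach k P) (run (mach k P) w 0)"
  then have "run (mach k P) w (Suc 0) = run (mach k P) w 0"
    by (rule run_halted) simp
  moreover have "fst (run (mach k P) w (Suc 0)) \<noteq> 0"
    by (simp add: run_def step_init_conf tm_conf_def)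
  ultimately show False
    by (simp add: run_def init_conf_def)
qed

lemma halted_mach_Suc:
  assumes "\<forall>I\<in>set P. ivars I \<subseteq> {..<k}"
  shows "halted (mach k P) (run (mach k P) w (Suc T)) \<longleftrightarrow> length P \<le> fst ((istep P ^^ T) (iinit w))"
  unfolding run_mach_Suc[OF assms]
  by (rule halted_tm_conf) (auto intro!: suffix_istep simp: iinit_def)

lemma conf_output_tm_conf: "conf_output (tm_conf k w (pc, s, i, out)) = out"
proof -
  have "(LEAST i. fst (input_tape out) (int i) \<notin> range Bit) = length out"
    by (rule Least_equality) (auto simp: input_tape_def not_less[symmetric])
  then have "tape_output (fst (input_tape out), h) = out" for h
    by (auto simp: input_tape_def intro!: nth_equalityI)
  then show ?thesis
    by (simp add: conf_output_def tm_conf_def itape.simps)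
qed

text \<open>An instruction writes at most one bit. Hence a machine with f(n) output bits runs for at
  least f(n) steps, which puts its running time above f.\<close>

lemma length_out_istep: "length (snd (snd (snd ((istep P ^^ T) (iinit w))))) \<le> T"
proof (induction T)
  case (Suc T)
  obtain pc s i out where c: "(istep P ^^ T) (iinit w) = (pc, s, i, out)"
    by (cases "(istep P ^^ T) (iinit w)")
  show ?case
    using Suc by (simp add: c split: instr.split)
qed (simp add: iinit_def)

text \<open>Partial functions are undefined where their programs end with a nonzero counter 0.\<close>

definition prog :: "com \<Rightarrow> instr list" where
  "prog c = compile 0 c @ [IJz 0 (csize c + 2), IJmp (Suc (csize c))]"

definition com_tm :: "com \<Rightarrow> tm" where
  "com_tm c = mach (SOME k. \<forall>I\<in>set (prog c). ivars I \<subseteq> {..<k}) (prog c)"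

lemma com_tm_eq_mach:
  obtains k where "com_tm c = mach k (prog c)" "\<forall>I\<in>set (prog c). ivars I \<subseteq> {..<k}"
proof -
  have "finite (ivars I)" for I
    by (cases I) auto
  then have "finite (\<Union>I\<in>set (prog c). ivars I)"
    by blast
  then have "\<exists>k. (\<Union>I\<in>set (prog c). ivars I) \<subseteq> {..<k}"
    by (simp add: finite_nat_iff_bounded)
  then have "\<exists>k. \<forall>I\<in>set (prog c). ivars I \<subseteq> {..<k}"
    by (simp add: UN_subset_iff)
  from someI_ex[OF this] show thesis
    using that unfolding com_tm_def by simp
qed

lemma is_tm_com_tm: "is_tm (com_tm c)"
  by (simp add: com_tm_def is_tm_mach)

lemma reaches_prog:
  assumes "exec c ((\<lambda>_. 0), w, []) \<sigma>"
  shows "reaches (prog c) (iinit w) (csize c, \<sigma>)"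
  using reaches_compile[OF assms, of "prog c" "[]"] by (simp add: prog_def iinit_def)

lemma computes_com_tm:
  assumes "exec c ((\<lambda>_. 0), w, []) (s, i, out)" "s 0 = 0"
  shows "computes (com_tm c) w out"
proof -
  obtain k where k: "com_tm c = mach k (prog c)" "\<forall>I\<in>set (prog c). ivars I \<subseteq> {..<k}"
    by (rule com_tm_eq_mach[of c])
  have "istep (prog c) (csize c, s, i, out) = (csize c + 2, s, i, out)"
    using assms(2) by (simp add: prog_def nth_append)
  then have "reaches (prog c) (iinit w) (csize c + 2, s, i, out)"
    by (metis reaches_prog[OF assms(1)] reaches_refl reaches_step reaches_trans)
  then obtain T where T: "(istep (prog c) ^^ T) (iinit w) = (csize c + 2, s, i, out)"
    by (auto simp: reaches_def)
  have "halted (com_tm c) (run (com_tm c) w (Suc T))"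
    unfolding k(1) halted_mach_Suc[OF k(2)] T by (simp add: prog_def)
  moreover have "conf_output (run (com_tm c) w (Suc T)) = out"
    unfolding k(1) run_mach_Suc[OF k(2)] T by (rule conf_output_tm_conf)
  ultimately have "computes_within (com_tm c) w (Suc T) out"
    by (simp add: computes_within_def)
  then show ?thesis by (auto simp: computes_def)
qed

lemma not_computes_com_tm:
  assumes "exec c ((\<lambda>_. 0), w, []) (s, i, out)" "s 0 \<noteq> 0"
  shows "\<not> computes (com_tm c) w x"
proof
  obtain k where k: "com_tm c = mach k (prog c)" "\<forall>I\<in>set (prog c). ivars I \<subseteq> {..<k}"
    by (rule com_tm_eq_mach[of c])
  assume "computes (com_tm c) w x"
  then obtain T' where T': "halted (com_tm c) (run (com_tm c) w T')"
    by (auto simp: computes_def computes_within_def)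
  have "istep (prog c) (csize c, s, i, out) = (Suc (csize c), s, i, out)"
    using assms(2) by (simp add: prog_def nth_append)
  then have "reaches (prog c) (iinit w) (Suc (csize c), s, i, out)"
    by (metis reaches_prog[OF assms(1)] reaches_refl reaches_step reaches_trans)
  then obtain T where T: "(istep (prog c) ^^ T) (iinit w) = (Suc (csize c), s, i, out)"
    by (auto simp: reaches_def)
  \<comment> \<open>The last instruction of \<open>prog c\<close> jumps to itself.\<close>
  have loop: "istep (prog c) (Suc (csize c), s, i, out) = (Suc (csize c), s, i, out)"
    by (simp add: prog_def nth_append)
  have "(istep (prog c) ^^ (n + T)) (iinit w) = (Suc (csize c), s, i, out)" for n
    by (induction n) (simp_all only: add_0 add_Suc funpow.simps o_apply T loop)
  then have "\<not> halted (com_tm c) (run (com_tm c) w (Suc (T' + T)))"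
    unfolding k(1) halted_mach_Suc[OF k(2)] by (simp add: prog_def)
  moreover have "halted (com_tm c) (run (com_tm c) w (Suc (T' + T)))"
    using run_halted[OF T', of "Suc (T' + T)"] T' by simp
  ultimately show False by contradiction
qed

subsection \<open>Input and output\<close>

text \<open>Counter 1 stays zero after a \<open>Read\<close> at the end of the input, which ends the
  loop. That last round still increments counter 0; the final \<open>Dec 0\<close> corrects
  this.\<close>

definition read_length :: com where
  "read_length = Inc 1 ;; While 1 (Dec 1 ;; Read 1 1 ;; Inc 0) ;; Dec 0"

definition cons_enc :: "bool \<Rightarrow> nat \<Rightarrow> nat" where
  "cons_enc b x = Suc (prod_encode (enc b, x))"

lemma wc_cons_enc: "wc (cons_enc b)"
  unfolding cons_enc_def by (intro wc_comp[OF wc_Suc] wc_pair wc_const wc_id)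

lemma cons_enc: "cons_enc b (enc bs) = enc (b # bs)"
  by (simp add: cons_enc_def enc_Cons)

text \<open>Counters 1 and 2 tell which bit was read; if both are zero the input is exhausted.
  Counter 3 keeps the loop alive.\<close>

definition read_bits :: com where
  "read_bits = Inc 3 ;; While 3 (Dec 3 ;; Read 1 2 ;;
     Cond 1 (Dec 1 ;; inplace (cons_enc True) 0 4 ;; Inc 3)
       (Cond 2 (Dec 2 ;; inplace (cons_enc False) 0 4 ;; Inc 3) (Dec 3)))"

definition write_bits :: com where
  "write_bits = While 0 (Dec 0 ;; unpair ;; Cond 0 (Dec 0 ;; Out True) (Out False) ;; add_to 0 1)"

lemma exec_read_bits: "exec read_bits ((\<lambda>_. 0), w, []) (single (enc (rev w)), [], [])"
proof -
  let ?c = "Dec 3 ;; Read 1 2 ;; Cond 1 (Dec 1 ;; inplace (cons_enc True) 0 4 ;; Inc 3)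
       (Cond 2 (Dec 2 ;; inplace (cons_enc False) 0 4 ;; Inc 3) (Dec 3))"
  let ?st = "\<lambda>bs. (single (enc bs))(3 := 1)"
  have body: "exec ?c (?st bs, b # i, []) (?st (b # bs), i, [])" for b bs i
  proof (cases b)
    case True
    have "exec (Dec 3) (?st bs, b # i, []) (single (enc bs), b # i, [])"
      by (rule exec_Dec') (simp add: single_def fun_eq_iff)
    moreover have "exec (Read 1 2) (single (enc bs), b # i, []) ((single (enc bs))(1 := 1), i, [])"
      using True by (simp only:) (rule exec_Read_True', simp add: single_def)
    moreover have "exec (Dec 1) ((single (enc bs))(1 := 1), i, []) (single (enc bs), i, [])"
      by (rule exec_Dec') (simp add: single_def fun_eq_iff)
    moreover have "exec (inplace (cons_enc True) 0 4) (single (enc bs), i, []) (single (enc (b # bs)), i, [])"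
      by (rule exec_inplace[OF wc_cons_enc]) (auto simp: single_def fun_eq_iff cons_enc True)
    moreover have "exec (Inc 3) (single (enc (b # bs)), i, []) (?st (b # bs), i, [])"
      by (rule exec_Inc') (simp add: single_def fun_eq_iff)
    moreover have "fst ((single (enc bs))(1 := 1), i, []) 1 \<noteq> 0"
      by simp
    ultimately show ?thesis
      by (intro exec_Seq[OF _ exec_Seq[OF _ exec_Cond_pos[OF _ exec_Seq[OF _ exec_Seq]]]])
  next
    case False
    have "exec (Dec 3) (?st bs, b # i, []) (single (enc bs), b # i, [])"
      by (rule exec_Dec') (simp add: single_def fun_eq_iff)
    moreover have "exec (Read 1 2) (single (enc bs), b # i, []) ((single (enc bs))(2 := 1), i, [])"
      using False by (simp only:) (rule exec_Read_False', simp add: single_def)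
    moreover have "exec (Dec 2) ((single (enc bs))(2 := 1), i, []) (single (enc bs), i, [])"
      by (rule exec_Dec') (simp add: single_def fun_eq_iff)
    moreover have "exec (inplace (cons_enc False) 0 4) (single (enc bs), i, []) (single (enc (b # bs)), i, [])"
      using False
      by (intro exec_inplace[OF wc_cons_enc]) (auto simp: single_def fun_eq_iff cons_enc)
    moreover have "exec (Inc 3) (single (enc (b # bs)), i, []) (?st (b # bs), i, [])"
      by (rule exec_Inc') (simp add: single_def fun_eq_iff)
    moreover have "fst ((single (enc bs))(2 := 1), i, []) 1 = 0"
      by (simp add: single_def)
    moreover have "fst ((single (enc bs))(2 := 1), i, []) 2 \<noteq> 0"
      by simp
    ultimately show ?thesis
      by (intro exec_Seq[OF _ exec_Seq[OF _ exec_Cond_zero[OF _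
        exec_Cond_pos[OF _ exec_Seq[OF _ exec_Seq]]]]])
  qed
  have last: "exec ?c (?st bs, [], []) (single (enc bs), [], [])" for bs
  proof -
    have "exec (Dec 3) (?st bs, [], []) (single (enc bs), [], [])"
      by (rule exec_Dec') (simp add: single_def fun_eq_iff)
    moreover have "exec (Dec 3) (single (enc bs), [], []) (single (enc bs), [], [])"
      by (rule exec_Dec') (simp add: single_def fun_eq_iff)
    moreover have "fst (single (enc bs), [], []) 1 = 0" "fst (single (enc bs), [], []) 2 = 0"
      by (simp_all add: single_def)
    ultimately show ?thesis
      by (intro exec_Seq[OF _ exec_Seq[OF exec_Read_end exec_Cond_zero[OF _ exec_Cond_zero]]])
  qed
  have loop: "exec (While 3 ?c) (?st bs, w, []) (single (enc (rev w @ bs)), [], [])" for bs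
  proof (induction w arbitrary: bs)
    case Nil
    have "exec (While 3 ?c) (single (enc bs), [], []) (single (enc bs), [], [])"
      by (rule exec_While_zero) (simp add: single_def)
    then show ?case
      by (simp only: rev.simps append.simps) (rule exec_While_pos[OF _ last], simp)
  next
    case (Cons b w)
    have "fst (?st bs, b # w, []) 3 \<noteq> 0" by simp
    from exec_While_pos[OF this body Cons.IH] show ?case
      by (simp only: rev.simps append.simps append_assoc)
  qed
  have "exec (Inc 3) ((\<lambda>_. 0), w, []) (?st [], w, [])"
    by (rule exec_Inc') (simp add: single_def fun_eq_iff enc_Nil)
  from exec_Seq[OF this loop] show ?thesis
    by (simp only: read_bits_def append_Nil2)
qed

lemma exec_write_bits: "exec write_bits (single (enc bs), i, out) ((\<lambda>_. 0), i, out @ bs)"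
proof (induction bs arbitrary: out)
  case Nil
  have "exec write_bits ((\<lambda>_. 0), i, out) ((\<lambda>_. 0), i, out)"
    unfolding write_bits_def by (rule exec_While_zero) simp
  moreover have "single (enc ([] :: bool list)) = (\<lambda>_. 0)"
    by (simp add: single_def enc_Nil fun_eq_iff)
  ultimately show ?case by simp
next
  case (Cons b bs)
  have "exec (Dec 0) (single (enc (b # bs)), i, out) (single (prod_encode (enc b, enc bs)), i, out)"
    by (rule exec_Dec') (simp add: single_def fun_eq_iff enc_Cons)
  moreover have "exec unpair (single (prod_encode (enc b, enc bs)), i, out) (two (enc b) (enc bs), i, out)"
    using exec_unpair[of "prod_encode (enc b, enc bs)"] by simp
  moreover have "exec (Cond 0 (Dec 0 ;; Out True) (Out False)) (two (enc b) (enc bs), i, out)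
      (two 0 (enc bs), i, out @ [b])"
  proof (cases b)
    case True
    have "exec (Dec 0) (two (enc b) (enc bs), i, out) (two 0 (enc bs), i, out)"
      by (rule exec_Dec') (simp add: two_def enc_bool_def True fun_eq_iff)
    from exec_Seq[OF this exec_Out[of True]] show ?thesis
      by (intro exec_Cond_pos) (simp_all add: two_def enc_bool_def True)
  next
    case False
    then show ?thesis
      by (intro exec_Cond_zero) (auto simp: two_def enc_bool_def exec_Out)
  qed
  moreover have "exec (add_to 0 1) (two 0 (enc bs), i, out @ [b]) (single (enc bs), i, out @ [b])"
    by (rule exec_add_to) (auto simp: two_def single_def fun_eq_iff)
  ultimately have body: "exec (Dec 0 ;; unpair ;; Cond 0 (Dec 0 ;; Out True) (Out False) ;; add_to 0 1)
      (single (enc (b # bs)), i, out) (single (enc bs), i, out @ [b])"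
    by (intro exec_Seq)
  have "fst (single (enc (b # bs)), i, out) 0 \<noteq> 0"
    by (simp add: single_def enc_Cons)
  from exec_While_pos[OF this body] Cons.IH[of "out @ [b]"] show ?case
    by (simp add: write_bits_def)
qed

text \<open>The machine must diverge wherever g is undefined: the decoder yields a prefix machine
  only if words that are not descriptions do not halt.\<close>

theorem partial_function_tm:
  fixes g :: "bool list \<Rightarrow> bool list option"
  assumes "cf g"
  obtains M where "is_tm M" "\<And>w x. computes M w x \<longleftrightarrow> g w = Some x"
proof -
  \<comment> \<open>Consing the bits as they come delivers the word reversed.\<close>
  have "cf (\<lambda>w. g (rev w))"
    by (rule cf_comp[OF assms]) (intro cf_intros)
  then obtain g' where g': "wc g'" "\<And>w. g' (enc w) = enc (g (rev w))"
    by (rule cfE) blast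
  \<comment> \<open>The code of \<open>Some x\<close> is a successor, which \<open>Dec 0\<close>
    strips; the code 0 of \<open>None\<close> is made 1 to trigger the infinite loop of
    \<open>prog\<close>.\<close>
  define c where "c = read_bits ;; inplace g' 0 1 ;; Cond 0 (Dec 0 ;; write_bits) (Inc 0)"
  have decoded: "exec (inplace g' 0 1) (single (enc (rev w)), [], []) (single (enc (g w)), [], [])" for w
    by (rule exec_inplace[OF g'(1)]) (auto simp: single_def fun_eq_iff g'(2))
  have some: "computes (com_tm c) w x" if "g w = Some x" for w x
  proof (rule computes_com_tm)
    have "exec (Dec 0) (single (enc (g w)), [], []) (single (enc x), [], [])"
      by (rule exec_Dec') (simp add: single_def fun_eq_iff that enc_option_def)
    moreover have "fst (single (enc (g w)), [], []) 0 \<noteq> 0"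
      by (simp add: single_def that enc_option_def)
    ultimately show "exec c ((\<lambda>_. 0), w, []) ((\<lambda>_. 0), [], x)"
      using exec_Seq[OF exec_read_bits exec_Seq[OF decoded exec_Cond_pos[OF _ exec_Seq[OF _ exec_write_bits]]]]
      unfolding c_def by force
  qed simp
  have none: "\<not> computes (com_tm c) w x" if "g w = None" for w x
  proof (rule not_computes_com_tm)
    have "exec (Inc 0) (single (enc (g w)), [], []) (single 1, [], [])"
      by (rule exec_Inc') (simp add: single_def fun_eq_iff that enc_option_def)
    moreover have "fst (single (enc (g w)), [], []) 0 = 0"
      by (simp add: single_def that enc_option_def)
    ultimately show "exec c ((\<lambda>_. 0), w, []) (single 1, [], [])"
      using exec_Seq[OF exec_read_bits exec_Seq[OF decoded exec_Cond_zero]]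
      unfolding c_def by blast
  qed (simp add: single_def)
  have "computes (com_tm c) w x \<longleftrightarrow> g w = Some x" for w x
    using some none computes_unique by (metis option.exhaust)
  then show thesis
    using that is_tm_com_tm by blast
qed

text \<open>
  The running time depends on the length of the input only because after \<open>read_length\<close>, which
  treats both bits alike, the rest of the run is determined by the length.
\<close>

lemma istep_read_length:
  assumes "P = compile 0 read_length @ ys"
  shows "(istep P ^^ (5 * length w + 8)) (iinit w) = (7, single (length w), [], [])"
proof -
  have P: "P = [IInc 1, IJz 1 6, IDec 1, IRead 1 1, IInc 0, IJmp 1, IDec 0] @ ys"
    by (simp add: assms read_length_def numeral_eq_Suc)
  have loop: "(istep P ^^ (5 * length w)) (1, two a 1, w, []) = (1, two (a + length w) 1, [], [])" for a
  proof (induction w arbitrary: a)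
    case (Cons b w)
    have "(istep P ^^ 5) (1, two a 1, b # w, []) = (1, two (Suc a) 1, w, [])"
      by (simp add: P numeral_eq_Suc two_def fun_eq_iff)
    moreover have "5 * length (b # w) = 5 * length w + 5" by simp
    ultimately show ?case
      using Cons.IH[of "Suc a"] by (simp only: funpow_add o_apply) simp
  qed simp
  have "istep P (iinit w) = (1, two 0 1, w, [])"
    by (simp add: iinit_def P two_def fun_eq_iff)
  moreover have "(istep P ^^ 7) (1, two (length w) 1, [], []) = (7, single (length w), [], [])"
    by (simp add: P numeral_eq_Suc two_def single_def fun_eq_iff)
  \<comment> \<open>One instruction enters the loop, each bit costs five, and seven remain: the
    round at the end of the input (5), the exit test and the decrement.\<close>
  moreover have "5 * length w + 8 = 7 + (5 * length w + 1)"
    by simp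
  ultimately show ?thesis
    using loop[of 0] by (simp only: funpow_add o_apply) simp
qed

lemma exec_read_length: "exec read_length ((\<lambda>_. 0), w, []) (single (length w), [], [])"
proof -
  let ?c = "Dec 1 ;; Read 1 1 ;; Inc 0"
  have body: "exec ?c (two a 1, b # i, []) (two (Suc a) 1, i, [])" for a b i
  proof -
    have "exec (Dec 1) (two a 1, b # i, []) (two a 0, b # i, [])"
      by (rule exec_Dec') (simp add: two_def fun_eq_iff)
    moreover have "exec (Read 1 1) (two a 0, b # i, []) (two a 1, i, [])"
      by (cases b; simp only:; intro exec_Read_True' exec_Read_False') (simp_all add: two_def fun_eq_iff)
    moreover have "exec (Inc 0) (two a 1, i, []) (two (Suc a) 1, i, [])"
      by (rule exec_Inc') (simp add: two_def fun_eq_iff)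
    ultimately show ?thesis by (intro exec_Seq)
  qed
  have last: "exec ?c (two a 1, [], []) (two (Suc a) 0, [], [])" for a
    by (rule exec_Seq[OF exec_Dec exec_Seq[OF exec_Read_end exec_Inc']]) (simp add: two_def fun_eq_iff)
  have loop: "exec (While 1 ?c) (two a 1, w, []) (two (a + Suc (length w)) 0, [], [])" for a
  proof (induction w arbitrary: a)
    case Nil
    have W: "exec (While 1 ?c) (two (Suc a) 0, [], []) (two (Suc a) 0, [], [])"
      by (rule exec_While_zero) (simp add: two_def)
    have "fst (two a 1, [], []) 1 \<noteq> 0" by (simp add: two_def)
    from exec_While_pos[OF this last W] show ?case by simp
  next
    case (Cons b w)
    have "fst (two a 1, b # w, []) 1 \<noteq> 0" by (simp add: two_def)
    from exec_While_pos[OF this body Cons.IH] show ?case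
      by simp
  qed
  have "exec (Inc 1) ((\<lambda>_. 0), w, []) (two 0 1, w, [])"
    by (rule exec_Inc') (simp add: two_def fun_eq_iff)
  moreover have "exec (Dec 0) (two (0 + Suc (length w)) 0, [], []) (single (length w), [], [])"
    by (rule exec_Dec') (simp add: two_def single_def fun_eq_iff)
  ultimately show ?thesis
    unfolding read_length_def using loop by (intro exec_Seq)
qed

theorem unary_function_tm:
  fixes f :: "nat \<Rightarrow> nat"
  assumes "cf f"
  obtains M \<tau> where "is_tm M" "\<And>w. computes M w (replicate (f (length w)) True)"
    "\<And>w. runtime_is M w (\<tau> (length w))" "\<And>n. f n \<le> \<tau> n"
proof -
  have "cf (\<lambda>n. enc (replicate (f n) True))"
    by (intro cf_intros assms)
  then obtain g where g: "wc g" "\<And>n. g n = enc (replicate (f n) True)"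
    by (rule cfE) (simp add: enc_nat_def)
  define c where "c = read_length ;; inplace g 0 1 ;; write_bits"
  define M where "M = com_tm c"
  have comp: "computes M w (replicate (f (length w)) True)" for w
    unfolding M_def
  proof (rule computes_com_tm)
    have "exec (inplace g 0 1) (single (length w), [], []) (single (enc (replicate (f (length w)) True)), [], [])"
      by (rule exec_inplace[OF g(1)]) (auto simp: single_def fun_eq_iff g(2))
    from exec_Seq[OF exec_read_length exec_Seq[OF this exec_write_bits]]
    show "exec c ((\<lambda>_. 0), w, []) ((\<lambda>_. 0), [], replicate (f (length w)) True)"
      by (simp add: c_def)
  qed simp
  obtain k where k: "com_tm c = mach k (prog c)" "\<forall>I\<in>set (prog c). ivars I \<subseteq> {..<k}"
    by (rule com_tm_eq_mach[of c])
  have "\<exists>ys. prog c = compile 0 read_length @ ys \<and> ys \<noteq> []"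
    by (simp add: prog_def c_def)
  then obtain ys where ys: "prog c = compile 0 read_length @ ys" "ys \<noteq> []"
    by blast
  have size: "csize read_length = 7"
    by (simp add: read_length_def)
  have halted_cong: "halted M (run M w T) \<longleftrightarrow> halted M (run M w' T)" if len: "length w = length w'" for w w' T
  proof -
    let ?T = "5 * length w + 8"
    \<comment> \<open>At step \<open>Suc ?T\<close> the program counter is 7, still inside the code
      since \<open>ys\<close> is nonempty; so no run has halted by then, whatever the bits.\<close>
    have early: "\<not> halted M (run M v T)" if "T \<le> Suc ?T" "length v = length w" for v
    proof
      assume "halted M (run M v T)"
      then have "halted M (run M v (Suc ?T))"
        using run_halted that(1) by metis
      then have "length (prog c) \<le> 7"
        using istep_read_length[OF ys(1), of v] that(2)
        unfolding M_def k(1) halted_mach_Suc[OF k(2)] by simp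
      then show False
        using ys size by simp
    qed
    show ?thesis
    proof (cases "T \<le> Suc ?T")
      case True
      then show ?thesis using early len by metis
    next
      case False
      then obtain d where T: "T = Suc (d + ?T)"
        by (metis Suc_le_D add.commute le_Suc_ex not_less_eq_eq nat_le_linear)
      show ?thesis
        unfolding M_def k(1) T halted_mach_Suc[OF k(2)] funpow_add[of d ?T] o_apply
        using istep_read_length[OF ys(1), of w] istep_read_length[OF ys(1), of w'] len by simp
    qed
  qed
  define \<tau> where "\<tau> n = (LEAST T. halted M (run M (replicate n True) T))" for n
  have \<tau>: "halted M (run M (replicate n True) (\<tau> n))" for n
    unfolding \<tau>_def using comp[of "replicate n True"]
    by (auto simp: computes_def computes_within_def intro: LeastI)
  have "runtime_is M w (\<tau> (length w))" for w
    unfolding runtime_is_def halted_cong[of w "replicate (length w) True", simplified]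
    using \<tau> not_less_Least unfolding \<tau>_def by blast
  moreover have "f n \<le> \<tau> n" for n
  proof -
    let ?w = "replicate n True"
    obtain T where T: "\<tau> n = Suc T"
      using \<tau>[of n] halted_mach_0 unfolding M_def k(1) by (metis not0_implies_Suc)
    have "computes M ?w (conf_output (run M ?w (\<tau> n)))"
      using \<tau>[of n] by (auto simp: computes_def computes_within_def)
    then have "conf_output (run M ?w (\<tau> n)) = replicate (f n) True"
      using comp[of ?w] computes_unique by fastforce
    moreover have "length (conf_output (run M ?w (Suc T))) \<le> T"
    proof -
      obtain pc s i out where c': "(istep (prog c) ^^ T) (iinit ?w) = (pc, s, i, out)"
        by (cases "(istep (prog c) ^^ T) (iinit ?w)")
      then show ?thesis
        using length_out_istep[of T "prog c" ?w]
        unfolding M_def k(1) run_mach_Suc[OF k(2)] c' conf_output_tm_conf by simp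
    qed
    ultimately show ?thesis
      by (simp add: T)
  qed
  ultimately show thesis
    using that is_tm_com_tm comp unfolding M_def by blast
qed

corollary recursive_fun_iff_cf: "recursive_fun f \<longleftrightarrow> cf f"
proof
  assume "cf f"
  then obtain M where "is_tm M" "\<And>w. computes M w (replicate (f (length w)) True)"
    by (rule unary_function_tm) blast
  then show "recursive_fun f"
    unfolding recursive_fun_def by (metis length_replicate)
qed (rule recursive_fun_imp_cf)

text \<open>\<open>ldepth\<close> minimises over time-constructible bounds, whereas
  \<open>super_deep\<close> is stated for recursive ones. The running time of a machine that writes
  f(n) bits is a bound of both kinds.\<close>

corollary time_constructible_above:
  assumes "recursive_fun f"
  obtains \<tau> where "time_constructible \<tau>" "recursive_fun \<tau>" "\<And>n. f n \<le> \<tau> n"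
proof -
  obtain M \<tau> where M: "is_tm M" "\<And>w. runtime_is M w (\<tau> (length w))" "\<And>n. f n \<le> \<tau> n"
    using assms unfolding recursive_fun_iff_cf by (rule unary_function_tm) blast
  then have "time_constructible \<tau>"
    by (auto simp: time_constructible_def)
  moreover have "recursive_fun \<tau>"
    unfolding recursive_fun_iff_cf by (rule runtime_is_imp_cf[OF M(1,2)])
  ultimately show thesis
    using that M(3) by blast
qed

section \<open>Time-bounded algorithmic probability\<close>

definition domain :: "tm \<Rightarrow> bool list set" where
  "domain U = {p. \<exists>x. computes U p x}"

definition wt :: "bool list \<Rightarrow> real" where
  "wt p = 1 / 2 ^ length p"

lemma domainI: "computes_within U p T x \<Longrightarrow> p \<in> domain U"
  by (auto simp: domain_def computes_def)

lemma finite_length_le: "finite {w :: bool list. length w \<le> n}"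
  using finite_lists_length_le[of "UNIV :: bool set" n] by simp

lemma card_length_eq: "card {w :: bool list. length w = n} = 2 ^ n"
  using card_lists_length_eq[of "UNIV :: bool set" n] by simp

lemma finite_length_eq: "finite {w :: bool list. length w = n}"
  using finite_lists_length_eq[of "UNIV :: bool set" n] by simp

text \<open>Extend every program to all words of a common length N. Prefix-freeness makes these sets
  of extensions disjoint, and there are only 2 ^ N words.\<close>

lemma kraft_inequality:
  assumes "prefix_tm U" "finite F" "F \<subseteq> domain U"
  shows "sum wt F \<le> 1"
proof -
  obtain N where N: "\<And>p. p \<in> F \<Longrightarrow> length p \<le> N"
    using finite_nat_set_iff_bounded_le[of "length ` F"] assms(2) by auto
  define ext where "ext p = (\<lambda>r. p @ r) ` {r :: bool list. length r = N - length p}" for p :: "bool list"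
  have card_ext: "card (ext p) = 2 ^ (N - length p)" for p
    unfolding ext_def by (subst card_image) (auto simp: inj_on_def card_length_eq)
  have fin: "finite (ext p)" for p
    by (simp add: ext_def finite_length_eq)
  have "card (\<Union>p\<in>F. ext p) = (\<Sum>p\<in>F. card (ext p))"
  proof (rule card_UN_disjoint)
    show "\<forall>p\<in>F. \<forall>q\<in>F. p \<noteq> q \<longrightarrow> ext p \<inter> ext q = {}"
    proof (intro ballI impI)
      fix p q assume pq: "p \<in> F" "q \<in> F" "p \<noteq> q"
      show "ext p \<inter> ext q = {}"
      proof (rule ccontr)
        assume "ext p \<inter> ext q \<noteq> {}"
        then obtain w where "prefix p w" "prefix q w"
          by (auto simp: ext_def prefix_def)
        then have "prefix p q \<or> prefix q p"
          using prefix_same_cases by blast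
        then show False
          using pq assms(1,3) unfolding prefix_tm_def domain_def by blast
      qed
    qed
  qed (auto simp: assms fin)
  moreover have "card (\<Union>p\<in>F. ext p) \<le> 2 ^ N"
    unfolding card_length_eq[symmetric]
    by (rule card_mono) (auto simp: finite_length_eq ext_def N)
  ultimately have "(\<Sum>p\<in>F. 2 ^ (N - length p)) \<le> (2 ^ N :: nat)"
    by (simp add: card_ext)
  then have "real (\<Sum>p\<in>F. 2 ^ (N - length p)) \<le> real (2 ^ N)"
    by (simp only: of_nat_le_iff)
  then have "(\<Sum>p\<in>F. 2 ^ (N - length p)) \<le> (2 ^ N :: real)"
    by simp
  moreover have "(\<Sum>p\<in>F. 2 ^ (N - length p)) = (\<Sum>p\<in>F. 2 ^ N * wt p)"
    by (rule sum.cong) (auto simp: wt_def power_diff N)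
  ultimately have "2 ^ N * sum wt F \<le> 2 ^ N"
    by (simp add: sum_distrib_left)
  then show ?thesis by simp
qed

text \<open>\<open>infsum\<close> is 0 on families that are not summable, so summability must
  precede every comparison of probabilities.\<close>

lemma summable_wt:
  assumes "prefix_tm U" "S \<subseteq> domain U"
  shows "wt summable_on S"
proof (rule nonneg_bdd_above_summable_on)
  show "bdd_above (sum wt ` {F. F \<subseteq> S \<and> finite F})"
    using kraft_inequality[OF assms(1)] assms(2) by (auto simp: bdd_above_def intro!: exI[of _ 1])
qed (simp add: wt_def)

lemma Q_eq: "Q U x = infsum wt {p. computes U p x}"
  by (simp add: Q_def wt_def[abs_def])

lemma Q_time_eq: "Q_time U t x = infsum wt {p. computes_within U p (t (length x)) x}"
  by (simp add: Q_time_def wt_def[abs_def])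

lemma Q_time_le_Q:
  assumes "prefix_tm U"
  shows "Q_time U t x \<le> Q U x"
proof -
  let ?A = "{p. computes_within U p (t (length x)) x}" and ?B = "{p. computes U p x}"
  have "?A \<subseteq> ?B" "?B \<subseteq> domain U"
    by (auto simp: computes_def domain_def)
  then show ?thesis
    unfolding Q_eq Q_time_eq
    by (intro infsum_mono2 summable_wt[OF assms]) (auto simp: wt_def)
qed

lemma Q_time_mono:
  assumes "prefix_tm U" "t (length x) \<le> t' (length x)"
  shows "Q_time U t x \<le> Q_time U t' x"
proof -
  let ?A = "\<lambda>t. {p. computes_within U p (t (length x)) x}"
  have "?A t \<subseteq> ?A t'" "?A t \<subseteq> domain U" "?A t' \<subseteq> domain U"
    using computes_within_mono[OF _ assms(2)] by (auto intro: domainI)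
  then show ?thesis
    unfolding Q_time_eq
    by (intro infsum_mono2 summable_wt[OF assms(1)]) (auto simp: wt_def)
qed

lemma wt_le_Q_time:
  assumes "prefix_tm U" "computes_within U p (t (length x)) x"
  shows "1 / 2 ^ length p \<le> Q_time U t x"
proof -
  have "sum wt {p} \<le> infsum wt {p. computes_within U p (t (length x)) x}"
    using assms(2) by (intro finite_sum_le_infsum summable_wt[OF assms(1)])
      (auto simp: wt_def intro: domainI)
  then show ?thesis by (simp add: Q_time_eq wt_def)
qed

subsection \<open>Halting computations read a bounded part of their programs\<close>

text \<open>Contents are compared only up to distance \<open>B\<close>, since the input tapes of a
  program and of its truncation differ further out; \<open>\<tau>\<close> bounds how far the heads
  have moved.\<close>

definition agree :: "int \<Rightarrow> nat \<Rightarrow> conf \<Rightarrow> conf \<Rightarrow> bool" where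
  "agree B \<tau> c c' \<longleftrightarrow> fst c = fst c' \<and>
     list_all2 (\<lambda>t t'. snd t = snd t' \<and> \<bar>snd t\<bar> \<le> int \<tau> \<and> (\<forall>i. \<bar>i\<bar> \<le> B \<longrightarrow> fst t i = fst t' i)) (snd c) (snd c')"

lemma agree_scanned:
  assumes "agree B \<tau> c c'" "int \<tau> \<le> B"
  shows "map scanned (snd c) = map scanned (snd c')"
proof -
  have scan: "scanned t = fst t (snd t)" for t by (cases t) simp
  show ?thesis
    using assms by (auto simp: agree_def list_all2_conv_all_nth scan intro!: nth_equalityI)
qed

lemma agree_step:
  assumes "agree B \<tau> c c'" "int \<tau> \<le> B"
  shows "agree B (Suc \<tau>) (step M c) (step M c')"
proof -
  obtain q ts q' ts' where c: "c = (q, ts)" "c' = (q', ts')"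
    by (cases c, cases c')
  have q: "q' = q" and scan: "map scanned ts' = map scanned ts" and len: "length ts' = length ts"
    using assms agree_scanned[OF assms] by (auto simp: c agree_def list_all2_lengthD)
  have act: "fst (act t a) = (fst t)(snd t := fst a)" "snd (act t a) = move (snd a) (snd t)" for t a
    by (cases t; cases a; simp)+
  have move: "\<bar>move d h\<bar> \<le> 1 + int \<tau>" if "\<bar>h\<bar> \<le> int \<tau>" for d h
    using that by (cases d) auto
  show ?thesis
  proof (cases "delta M (q, map scanned ts)")
    case None
    then show ?thesis
      using assms by (force simp: c q scan agree_def elim!: list_all2_mono)
  next
    case (Some qa)
    obtain r as where qa: "qa = (r, as)" by (cases qa)
    show ?thesis
      using assms Some
      by (auto simp: c q scan qa agree_def list_all2_conv_all_nth act move)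
  qed
qed

lemma agree_run:
  assumes "p' = take (Suc T) p" "\<tau> \<le> T"
  shows "agree (int T) \<tau> (run M p \<tau>) (run M p' \<tau>)"
  using assms(2)
proof (induction \<tau>)
  case 0
  have "input_tape p' = (\<lambda>i. if i \<le> int T then fst (input_tape p) i else Blank, 0)"
    by (auto simp: assms(1) input_tape_def fun_eq_iff)
  then show ?case
    by (auto simp: run_def init_conf_def agree_def list_all2_conv_all_nth nth_Cons input_tape_def
      split: nat.split)
next
  case (Suc \<tau>)
  then show ?case using agree_step[of "int T" \<tau>] by (simp add: run_def)
qed

text \<open>In T steps the heads stay within distance T, so the first T + 1 bits of the program
  already lead to the same halting run. This truncation is thus a halting prefix of a halting
  program and must be all of it.\<close>

lemma computes_within_length_le:
  assumes "prefix_tm U" "computes_within U p T x"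
  shows "length p \<le> Suc T"
proof -
  define q where "q = take (Suc T) p"
  have "agree (int T) T (run U p T) (run U q T)"
    by (rule agree_run) (auto simp: q_def)
  then have "halted U (run U q T) \<longleftrightarrow> halted U (run U p T)"
    using agree_scanned[of "int T" T] by (cases "run U p T"; cases "run U q T") (auto simp: agree_def)
  then have "computes U q (conf_output (run U q T))"
    using assms(2) by (auto simp: computes_within_def computes_def)
  moreover have "computes U p x"
    using assms(2) by (auto simp: computes_def)
  moreover have "prefix q p"
    by (simp add: q_def take_is_prefix)
  ultimately have "q = p"
    using assms(1) unfolding prefix_tm_def by blast
  then show ?thesis
    by (metis q_def length_take min.cobounded2)
qed

subsection \<open>Enumerating programs and candidates\<close>

definition strs :: "nat \<Rightarrow> bool list list" where
  "strs n = ((\<lambda>l. map (\<lambda>w. True # w) l @ map (\<lambda>w. False # w) l) ^^ n) [[]]"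

lemma strs_0: "strs 0 = [[]]"
  by (simp add: strs_def)

lemma strs_Suc: "strs (Suc n) = map (\<lambda>w. True # w) (strs n) @ map (\<lambda>w. False # w) (strs n)"
  by (simp add: strs_def)

lemma cf_strs [cf_intros]: "cf n \<Longrightarrow> cf (\<lambda>x. strs (n x))"
  unfolding strs_def by (intro cf_intros)

lemma set_strs: "set (strs n) = {w. length w = n}"
proof (induction n)
  case (Suc n)
  have "w \<in> set (strs (Suc n)) \<longleftrightarrow> length w = Suc n" for w
    by (cases w) (auto simp: strs_Suc Suc image_iff)
  then show ?case by auto
qed (auto simp: strs_0)

lemma distinct_strs: "distinct (strs n)"
  by (induction n) (auto simp: strs_0 strs_Suc distinct_map)

lemma length_strs: "length (strs n) = 2 ^ n"
  by (induction n) (auto simp: strs_0 strs_Suc)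

definition strs_le :: "nat \<Rightarrow> bool list list" where
  "strs_le n = concat (map (\<lambda>k. strs k) [0..<Suc n])"

lemma cf_strs_le [cf_intros]: "cf n \<Longrightarrow> cf (\<lambda>x. strs_le (n x))"
  unfolding strs_le_def by (intro cf_intros)

lemma set_strs_le: "set (strs_le n) = {w. length w \<le> n}"
  by (auto simp: strs_le_def set_strs)

lemma distinct_strs_le: "distinct (strs_le n)"
proof (induction n)
  case (Suc n)
  have "strs_le (Suc n) = strs_le n @ strs (Suc n)"
    by (simp add: strs_le_def)
  with Suc show ?case
    by (auto simp: distinct_strs set_strs set_strs_le)
qed (simp add: strs_le_def strs_0)

text \<open>\<open>Q_time\<close> times its common denominator 2 ^ (T + 1), which exists because
  programs halting within T steps have length at most T + 1. Thresholds can then be tested in exact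
  integer arithmetic.\<close>

definition weight :: "tm \<Rightarrow> nat \<Rightarrow> bool list \<Rightarrow> nat" where
  "weight U T x = sum_list (map (\<lambda>p. if computes_within U p T x then 2 ^ (Suc T - length p) else 0)
     (strs_le (Suc T)))"

lemma cf_weight [cf_intros]:
  assumes "is_tm U" "cf T" "cf y"
  shows "cf (\<lambda>x. weight U (T x) (y x))"
proof (rule cf_comp2[of "weight U"])
  show "cf (\<lambda>z. weight U (fst z) (snd z))"
    unfolding weight_def by (intro cf_intros assms(1))
qed (rule assms)+

lemma Q_time_eq_weight:
  assumes "prefix_tm U"
  shows "Q_time U t x = real (weight U (t (length x)) x) / 2 ^ Suc (t (length x))"
proof -
  let ?T = "t (length x)"
  let ?S = "{p. computes_within U p ?T x}"
  have sub: "?S \<subseteq> {w. length w \<le> Suc ?T}"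
    using computes_within_length_le[OF assms] by auto
  have fin: "finite ?S"
    by (rule finite_subset[OF sub finite_length_le])
  have "weight U ?T x = (\<Sum>p\<in>{w. length w \<le> Suc ?T}. if computes_within U p ?T x then 2 ^ (Suc ?T - length p) else 0)"
    unfolding weight_def by (simp add: sum_list_distinct_conv_sum_set distinct_strs_le set_strs_le)
  also have "\<dots> = (\<Sum>p\<in>?S. 2 ^ (Suc ?T - length p))"
  proof -
    have "{w. length w \<le> Suc ?T} \<inter> ?S = ?S"
      using sub by auto
    then show ?thesis
      by (simp add: sum.If_cases finite_length_le)
  qed
  finally have "real (weight U ?T x) = (\<Sum>p\<in>?S. 2 ^ (Suc ?T - length p))"
    by simp
  also have "\<dots> = (\<Sum>p\<in>?S. 2 ^ Suc ?T * wt p)"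
    by (rule sum.cong) (use sub in \<open>auto simp: wt_def power_diff\<close>)
  also have "\<dots> = 2 ^ Suc ?T * Q_time U t x"
    using fin by (simp add: Q_time_eq sum_distrib_left)
  finally show ?thesis by (simp add: field_simps)
qed

text \<open>Programs with different outputs are different, so the sum runs over one finite set of
  halting programs and Kraft's inequality applies.\<close>

lemma sum_Q_time_le_1:
  assumes "prefix_tm U" "finite X"
  shows "(\<Sum>x\<in>X. Q_time U t x) \<le> 1"
proof -
  let ?S = "\<lambda>x. {p. computes_within U p (t (length x)) x}"
  have fin: "finite (?S x)" for x
    using computes_within_length_le[OF assms(1)]
    by (intro finite_subset[OF _ finite_length_le[of "Suc (t (length x))"]]) auto
  have "(\<Sum>x\<in>X. Q_time U t x) = (\<Sum>x\<in>X. sum wt (?S x))"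
    using fin by (simp add: Q_time_eq)
  also have "\<dots> = sum wt (\<Union>x\<in>X. ?S x)"
    using assms(2) fin
    by (subst sum.UNION_disjoint) (auto dest: computes_within_unique)
  also have "\<dots> \<le> 1"
    using assms fin by (intro kraft_inequality[OF assms(1)]) (auto intro: domainI)
  finally show ?thesis .
qed

text \<open>
  All strings of length \<open>n\<close> are candidates if \<open>m \<ge> n\<close>, so that \<open>m \<le> n\<close> suffices for describing them.
\<close>

definition cand :: "tm \<Rightarrow> (nat \<Rightarrow> nat) \<Rightarrow> nat \<Rightarrow> nat \<Rightarrow> bool list list" where
  "cand U t n m = filter (\<lambda>x. n \<le> m \<or> 2 ^ Suc (t n) \<le> weight U (t n) x * 2 ^ m) (strs n)"

lemma cf_cand [cf_intros]:
  assumes "is_tm U" "cf t" "cf n" "cf m"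
  shows "cf (\<lambda>x. cand U t (n x) (m x))"
proof (rule cf_comp2[of "cand U t"])
  show "cf (\<lambda>z. cand U t (fst z) (snd z))"
    unfolding cand_def by (intro cf_intros cf_comp[OF assms(2)] assms(1))
qed (rule assms)+

lemma set_cand:
  assumes "prefix_tm U"
  shows "set (cand U t n m) = {x. length x = n \<and> (n \<le> m \<or> 1 / 2 ^ m \<le> Q_time U t x)}"
proof -
  have "2 ^ Suc (t n) \<le> weight U (t n) x * 2 ^ m \<longleftrightarrow> 1 / 2 ^ m \<le> Q_time U t x" if "length x = n" for x
  proof -
    have "2 ^ Suc (t n) \<le> weight U (t n) x * 2 ^ m \<longleftrightarrow>
        real (2 ^ Suc (t n)) \<le> real (weight U (t n) x * 2 ^ m)"
      by (simp only: of_nat_le_iff)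
    also have "\<dots> \<longleftrightarrow> 1 / 2 ^ m \<le> Q_time U t x"
      unfolding Q_time_eq_weight[OF assms] that by (simp add: field_simps)
    finally show ?thesis .
  qed
  then show ?thesis
    by (auto simp: cand_def set_strs)
qed

lemma length_cand_le:
  assumes "prefix_tm U"
  shows "length (cand U t n m) \<le> 2 ^ m"
proof (cases "n \<le> m")
  case True
  have "length (cand U t n m) \<le> 2 ^ n"
    unfolding cand_def length_strs[symmetric] by (rule length_filter_le)
  also have "\<dots> \<le> 2 ^ m"
    using True by simp
  finally show ?thesis .
next
  case False
  let ?X = "set (cand U t n m)"
  have "real (card ?X) * (1 / 2 ^ m) \<le> (\<Sum>x\<in>?X. Q_time U t x)"
    using False by (intro sum_bounded_below) (auto simp: set_cand[OF assms])
  also have "\<dots> \<le> 1"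
    by (rule sum_Q_time_le_1[OF assms]) simp
  finally have "real (card ?X) \<le> real (2 ^ m)"
    by (simp add: field_simps)
  moreover have "card ?X = length (cand U t n m)"
    by (rule distinct_card) (simp add: cand_def distinct_strs)
  ultimately show ?thesis by (simp only: of_nat_le_iff)
qed

section \<open>The time-bounded coding theorem\<close>

definition unary :: "nat \<Rightarrow> bool list" where
  "unary a = replicate a True @ [False]"

definition strip :: "bool list \<Rightarrow> bool list" where
  "strip w = ((\<lambda>l. if l \<noteq> [] \<and> hd l then tl l else l) ^^ length w) w"

lemma cf_strip [cf_intros]: "cf w \<Longrightarrow> cf (\<lambda>x. strip (w x))"
  unfolding strip_def by (intro cf_intros)

lemma strip_unary: "strip (unary a @ r) = False # r"
proof -
  let ?f = "\<lambda>l :: bool list. if l \<noteq> [] \<and> hd l then tl l else l"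
  have 1: "(?f ^^ a) (replicate a True @ False # r) = False # r" for a
  proof (induction a)
    case (Suc a)
    then show ?case by (simp add: funpow_Suc_right del: funpow.simps)
  qed simp
  have 2: "(?f ^^ k) (False # r) = False # r" for k
    by (induction k) auto
  have "length (unary a @ r) = Suc (length r) + a"
    by (simp add: unary_def)
  then have "strip (unary a @ r) = (?f ^^ Suc (length r)) ((?f ^^ a) (unary a @ r))"
    by (simp only: strip_def funpow_add o_apply)
  then show ?thesis
    using 1 2 by (simp only: unary_def append_assoc append.simps)
qed

definition read_unary :: "bool list \<Rightarrow> nat \<times> bool list" where
  "read_unary w = (length w - length (strip w), tl (strip w))"

lemma cf_read_unary [cf_intros]: "cf w \<Longrightarrow> cf (\<lambda>x. read_unary (w x))"
  unfolding read_unary_def by (intro cf_intros)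

lemma read_unary: "read_unary (unary a @ r) = (a, r)"
  by (simp add: read_unary_def strip_unary) (simp add: unary_def)

text \<open>
  The two components of \<open>prod_decode n\<close> are of order \<open>sqrt n\<close>, so writing them in unary is a
  self-delimiting code of sublinear length.
\<close>

definition hdr :: "nat \<Rightarrow> bool list" where
  "hdr n = unary (fst (prod_decode n)) @ unary (snd (prod_decode n))"

definition read_hdr :: "bool list \<Rightarrow> nat \<times> bool list" where
  "read_hdr w = (prod_encode (fst (read_unary w), fst (read_unary (snd (read_unary w)))),
     snd (read_unary (snd (read_unary w))))"

lemma read_hdr: "read_hdr (hdr n @ r) = (n, r)"
  by (simp add: read_hdr_def hdr_def read_unary)

lemma cf_hdr [cf_intros]: "cf n \<Longrightarrow> cf (\<lambda>x. hdr (n x))"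
proof (rule cf_comp[of hdr])
  have "cf (\<lambda>n. fst (prod_decode n))" "cf (\<lambda>n. snd (prod_decode n))"
    by (rule cfI[OF wc_fst] cfI[OF wc_snd], simp add: enc_nat_def)+
  then show "cf hdr"
    unfolding hdr_def unary_def by (intro cf_append cf_replicate cf_const)
qed

lemma cf_read_hdr [cf_intros]: "cf w \<Longrightarrow> cf (\<lambda>x. read_hdr (w x))"
proof -
  have "prod_encode (a, b) = enc (a, b)" for a b :: nat
    by (simp add: enc_Pair enc_nat_def)
  then show "cf w \<Longrightarrow> ?thesis"
    unfolding read_hdr_def by (simp only:) (intro cf_intros)
qed

text \<open>The diagonal of (a, b) begins at the triangular number of a + b, whence (a + b)^2 \<le>
  2n; the summand 2 counts the two end markers.\<close>

lemma length_hdr_le: "real (length (hdr n)) \<le> sqrt (2 * real n) + 2"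
proof -
  obtain a b where ab: "prod_decode n = (a, b)" by force
  then have "n = prod_encode (a, b)"
    by (metis prod_decode_inverse)
  then have "triangle (a + b) \<le> n"
    by (simp add: prod_encode_def)
  moreover have "2 * triangle (a + b) = (a + b) * Suc (a + b)"
    by (simp add: triangle_def)
  ultimately have "(a + b) * (a + b) \<le> 2 * n"
    by simp
  then have "real ((a + b) * (a + b)) \<le> real (2 * n)"
    by (simp only: of_nat_le_iff)
  then have "real (a + b) \<le> sqrt (2 * real n)"
    by (intro real_le_rsqrt) (simp add: power2_eq_square)
  then show ?thesis
    by (simp add: hdr_def ab unary_def)
qed

section \<open>The decoder\<close>

definition part_n :: "bool list \<Rightarrow> nat" where
  "part_n w = fst (read_hdr w)"

definition part_m :: "bool list \<Rightarrow> nat" where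
  "part_m w = fst (read_hdr (snd (read_hdr w)))"

definition part_r :: "bool list \<Rightarrow> bool list" where
  "part_r w = snd (read_hdr (snd (read_hdr w)))"

lemma parts:
  "part_n (hdr n @ hdr m @ r) = n" "part_m (hdr n @ hdr m @ r) = m" "part_r (hdr n @ hdr m @ r) = r"
  by (simp_all add: part_n_def part_m_def part_r_def read_hdr)

text \<open>The index of a candidate is not a numeral but the string of length m at the same
  position of \<open>strs\<close>; pairing both lists does the lookup.\<close>

definition matches :: "tm \<Rightarrow> (nat \<Rightarrow> nat) \<Rightarrow> bool list \<Rightarrow> (bool list \<times> bool list) list" where
  "matches U t w =
     filter (\<lambda>e. fst e = part_r w) (zip (strs (part_m w)) (cand U t (part_n w) (part_m w)))"

text \<open>The readers are total and return something on malformed words too; encoding the parts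
  again and comparing with w rejects these.\<close>

definition decode :: "tm \<Rightarrow> (nat \<Rightarrow> nat) \<Rightarrow> bool list \<Rightarrow> bool list option" where
  "decode U t w =
     (if w = hdr (part_n w) @ hdr (part_m w) @ part_r w \<and> length (part_r w) = part_m w \<and> matches U t w \<noteq> []
      then Some (snd (hd (matches U t w))) else None)"

lemma cf_decode:
  assumes "is_tm U" "cf t"
  shows "cf (decode U t)"
proof -
  have parts: "cf part_n" "cf part_m" "cf part_r"
    unfolding part_n_def part_m_def part_r_def by (intro cf_intros)+
  note lifted = parts[THEN cf_comp]
  have "cf (matches U t)"
    unfolding matches_def by (intro cf_intros lifted assms)
  then show ?thesis
    unfolding decode_def by (intro cf_intros parts)
qed

text \<open>The headers delimit themselves, so p and its extension q have the same m, and m fixes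
  the length of what follows.\<close>

lemma decode_prefix_free:
  assumes "decode U t p = Some x" "decode U t q = Some y" "prefix p q"
  shows "p = q"
proof -
  have p: "p = hdr (part_n p) @ hdr (part_m p) @ part_r p" "length (part_r p) = part_m p"
    and q: "q = hdr (part_n q) @ hdr (part_m q) @ part_r q" "length (part_r q) = part_m q"
    using assms(1,2) by (auto simp: decode_def split: if_splits)
  obtain z where z: "q = p @ z" using assms(3) by (auto simp: prefix_def)
  then have "q = hdr (part_n p) @ hdr (part_m p) @ (part_r p @ z)"
    by (metis p(1) append_assoc)
  then have "part_m q = part_m p" "part_r q = part_r p @ z"
    by (metis parts)+
  then have "z = []"
    using p(2) q(2) by simp
  then show ?thesis using z by simp
qed

lemma decode_surj:
  assumes "prefix_tm U" "x \<in> set (cand U t n m)"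
  obtains r where "length r = m" "decode U t (hdr n @ hdr m @ r) = Some x"
proof -
  obtain j where j: "j < length (cand U t n m)" "cand U t n m ! j = x"
    using assms(2) by (auto simp: in_set_conv_nth)
  \<comment> \<open>\<open>zip\<close> stops at the shorter list; there being at most 2 ^ m
    candidates, none is cut off.\<close>
  have jm: "j < length (strs m)"
    using j(1) length_cand_le[OF assms(1), of t n m] by (simp add: length_strs)
  define r where "r = strs m ! j"
  have r: "length r = m"
    using jm nth_mem[of j "strs m"] by (simp add: r_def set_strs)
  let ?w = "hdr n @ hdr m @ r"
  have snd: "snd e = x" if "e \<in> set (matches U t ?w)" for e
  proof -
    have e: "e \<in> set (zip (strs m) (cand U t n m))" "fst e = r"
      using that by (auto simp: matches_def parts)
    then obtain k where k: "strs m ! k = r" "cand U t n m ! k = snd e" "k < length (strs m)"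
      unfolding in_set_zip by auto
    then have "k = j"
      using jm distinct_strs[of m] by (simp add: r_def nth_eq_iff_index_eq)
    then show ?thesis using k j by simp
  qed
  have "(r, x) \<in> set (matches U t ?w)"
    using j jm by (auto simp: matches_def parts set_zip r_def)
  then have "matches U t ?w \<noteq> []" by auto
  then have "decode U t ?w = Some x"
    using r snd[OF hd_in_set] by (simp add: decode_def parts)
  with r show thesis using that by blast
qed

lemma ex_uniform_bound:
  assumes "finite A" "\<And>a. a \<in> A \<Longrightarrow> \<exists>T :: nat. R a T" "\<And>a T T'. R a T \<Longrightarrow> T \<le> T' \<Longrightarrow> R a T'"
  shows "\<exists>T. \<forall>a\<in>A. R a T"
  using assms(1,2)
proof (induction A rule: finite_induct)
  case (insert a A)
  then obtain T T' where "\<forall>a\<in>A. R a T" "R a T'" by blast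
  then have "\<forall>b\<in>insert a A. R b (max T T')"
    using assms(3) by (metis insert_iff max.cobounded1 max.cobounded2)
  then show ?case by blast
qed simp

theorem coding_theorem:
  assumes "universal_prefix_tm U" "recursive_fun t"
  obtains t' C where "recursive_fun t'"
    "\<And>x m. m \<le> length x \<Longrightarrow> m = length x \<or> 1 / 2 ^ m \<le> Q_time U t x \<Longrightarrow>
      K_time U t' x \<le> enat (C + length (hdr (length x)) + length (hdr m) + m)"
proof -
  have U: "prefix_tm U" "is_tm U"
    using assms(1) by (auto simp: universal_prefix_tm_def prefix_tm_def)
  have t: "cf t"
    by (rule recursive_fun_imp_cf[OF assms(2)])
  obtain M where M: "is_tm M" "\<And>w x. computes M w x \<longleftrightarrow> decode U t w = Some x"
    using partial_function_tm[OF cf_decode[OF U(2) t]] by blast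
  have "prefix_tm M"
    using M decode_prefix_free unfolding prefix_tm_def by blast
  then obtain c where c: "\<And>p x. computes U (c @ p) x \<longleftrightarrow> decode U t p = Some x"
    using assms(1) M(2) unfolding universal_prefix_tm_def by metis
  let ?l = "\<lambda>n m. length c + length (hdr n) + length (hdr m) + m"
  \<comment> \<open>The time \<open>U\<close> spends on the descriptions is unknown, so it is
    searched for. Any program of the right length is accepted, which is all that
    \<open>K_time\<close> needs and makes the condition decidable.\<close>
  define found where "found n T \<longleftrightarrow> (\<forall>m\<in>set [0..<Suc n]. \<forall>x\<in>set (cand U t n m).
    \<exists>q\<in>set (strs (?l n m)). computes_within U q T x)" for n T
  have ex: "\<exists>T. found n T" for n
    unfolding found_def
  proof (intro ex_uniform_bound)
    fix m x assume "x \<in> set (cand U t n m)"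
    with U(1) obtain r where r: "length r = m" "decode U t (hdr n @ hdr m @ r) = Some x"
      by (rule decode_surj)
    then obtain T where "computes_within U (c @ hdr n @ hdr m @ r) T x"
      using c by (auto simp: computes_def)
    then show "\<exists>T. \<exists>q\<in>set (strs (?l n m)). computes_within U q T x"
      using r(1) by (intro exI[of _ T] bexI[of _ "c @ hdr n @ hdr m @ r"]) (simp_all add: set_strs)
  qed (use computes_within_mono in blast)+
  define t' where "t' n = (LEAST T. found n T)" for n
  have "recursive_fun t'"
    unfolding recursive_fun_iff_cf t'_def
  proof (rule cf_Least)
    show "cf (\<lambda>z. found (fst z) (snd z))"
      unfolding found_def by (intro cf_intros U(2) t)
  qed (rule ex)
  moreover have "K_time U t' x \<le> enat (?l (length x) m)"
    if m: "m \<le> length x" "m = length x \<or> 1 / 2 ^ m \<le> Q_time U t x" for x m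
  proof -
    have "found (length x) (t' (length x))"
      unfolding t'_def by (rule LeastI_ex) (rule ex)
    moreover have "x \<in> set (cand U t (length x) m)"
      using m by (auto simp: set_cand[OF U(1)])
    ultimately obtain q where "length q = ?l (length x) m" "computes_within U q (t' (length x)) x"
      using m(1) by (force simp: found_def set_strs simp del: upt_Suc)
    then show ?thesis
      unfolding K_time_def by (metis (mono_tags, lifting) INF_lower mem_Collect_eq)
  qed
  ultimately show thesis
    using that by blast
qed

section \<open>Super deep sequences\<close>

lemma INF_le_enatE:
  assumes "(INF a\<in>A. f a) \<le> enat k"
  obtains a where "a \<in> A" "f a \<le> enat k"
proof -
  have "(INF a\<in>A. f a) < enat (Suc k)"
    using assms by (rule le_less_trans) simp
  then obtain a where a: "a \<in> A" "f a < enat (Suc k)"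
    unfolding INF_less_iff by blast
  then have "f a \<le> enat k"
    by (cases "f a") auto
  with a show thesis using that by blast
qed

lemma K_time_eq_enatE:
  assumes "K_time U t x = enat k"
  obtains p where "computes_within U p (t (length x)) x" "length p = k"
proof -
  let ?A = "{p. computes_within U p (t (length x)) x}"
  have "(INF p\<in>?A. enat (length p)) \<le> enat k"
    using assms by (simp add: K_time_def)
  then obtain p where p: "p \<in> ?A" "enat (length p) \<le> enat k"
    by (rule INF_le_enatE)
  have "K_time U t x \<le> enat (length p)"
    unfolding K_time_def by (rule INF_lower) (rule p(1))
  with p assms show thesis
    using that by simp
qed

lemma Q_nonneg: "0 \<le> Q U x"
  unfolding Q_def by (rule infsum_nonneg) simp

abbreviation depth_deficiency :: "tm \<Rightarrow> (nat \<Rightarrow> nat) \<Rightarrow> bool list \<Rightarrow> ereal" where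
  "depth_deficiency U t x \<equiv> deficiency U x (\<lambda>x. two_powr_minus (K_time U t x))"

lemma depth_deficiency_infinite: "K_time U t x = \<infinity> \<Longrightarrow> depth_deficiency U t x = \<infinity>"
  by (simp add: deficiency_def)

lemma depth_deficiency_finite:
  "K_time U t x = enat k \<Longrightarrow> depth_deficiency U t x = ereal (of_int \<lfloor>log 2 (Q U x * 2 ^ k)\<rfloor>)"
  by (simp add: deficiency_def)

lemma one_le_Q_mult:
  assumes "prefix_tm U" "K_time U t x = enat k"
  shows "1 \<le> Q U x * 2 ^ k"
proof -
  obtain p where "computes_within U p (t (length x)) x" "length p = k"
    using assms(2) by (rule K_time_eq_enatE)
  then have "1 / 2 ^ k \<le> Q U x"
    using wt_le_Q_time[OF assms(1)] Q_time_le_Q[OF assms(1)] order_trans by blast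
  then show ?thesis by (simp add: field_simps)
qed

lemma depth_deficiency_nonneg:
  assumes "prefix_tm U"
  shows "0 \<le> depth_deficiency U t x"
proof (cases "K_time U t x")
  case (enat k)
  have "0 \<le> log 2 (Q U x * 2 ^ k)"
    using one_le_Q_mult[OF assms enat] by simp
  then show ?thesis
    by (simp add: depth_deficiency_finite[OF enat])
next
  case infinity
  then show ?thesis by (simp add: depth_deficiency_infinite)
qed

lemma ldepth_leE:
  assumes "prefix_tm U" "ldepth U b x \<le> enat (t (length x))"
  shows "0 < Q U x" "Q U x \<le> 2 ^ b * Q_time U t x"
proof -
  obtain u where u: "Q_time U u x / Q U x \<ge> 1 / 2 ^ b" "u (length x) \<le> t (length x)"
    using assms(2) unfolding ldepth_def by (rule INF_le_enatE) auto
  \<comment> \<open>Division by zero gives 0, which is below every significance threshold.\<close>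
  have "Q U x \<noteq> 0"
  proof
    assume "Q U x = 0"
    then have "1 / 2 ^ b \<le> (0 :: real)" using u(1) by simp
    moreover have "0 < 1 / (2 ^ b :: real)" by simp
    ultimately show False by linarith
  qed
  then show pos: "0 < Q U x"
    using Q_nonneg[of U x] by linarith
  then have "Q U x \<le> 2 ^ b * Q_time U u x"
    using u(1) by (simp add: field_simps)
  \<comment> \<open>\<open>u\<close> and \<open>t\<close> need only be compared at the length of
    x.\<close>
  also have "\<dots> \<le> 2 ^ b * Q_time U t x"
    using Q_time_mono[where t = u and t' = t, OF assms(1) u(2)] by simp
  finally show "Q U x \<le> 2 ^ b * Q_time U t x" .
qed

text \<open>Write q for \<open>Q_time U t x\<close>. The depth gives Q \<le> 2^b q, and the coding
  theorem gives 2^K \<le> 2^(C + h) 2^m with h the length of the headers. The least suitable m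
  satisfies 2^m q \<le> 2, so Q 2^K is at most 2^(b + 1 + C + h).\<close>

lemma depth_deficiency_le:
  assumes U: "prefix_tm U"
    and coding: "\<And>x m. m \<le> length x \<Longrightarrow> m = length x \<or> 1 / 2 ^ m \<le> Q_time U t x \<Longrightarrow>
      K_time U t' x \<le> enat (C + length (hdr (length x)) + length (hdr m) + m)"
    and depth: "ldepth U b x \<le> enat (t (length x))"
  shows "depth_deficiency U t' x \<le> ereal (real b + 1 + real C + 2 * (sqrt (2 * real (length x)) + 2))"
proof -
  let ?n = "length x" and ?q = "Q_time U t x"
  note Q = ldepth_leE[where t = t, OF U depth]
  have q: "0 < ?q"
    using Q by (smt (verit) mult_nonneg_nonpos zero_le_power)
  define m0 where "m0 = (LEAST m. 1 / 2 ^ m \<le> ?q)"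
  obtain j where "(1 / 2) ^ j < ?q"
    using real_arch_pow_inv[OF q, of "1 / 2"] by auto
  then have "1 / 2 ^ j \<le> ?q"
    by (simp add: power_one_over)
  then have m0: "1 / 2 ^ m0 \<le> ?q"
    unfolding m0_def by (rule LeastI)
  have m0_le: "2 ^ m0 * ?q \<le> 2"
  \<comment> \<open>For m0 = 0 minimality says nothing; there q \<le> 1 is used.\<close>
  proof (cases m0)
    case 0
    then show ?thesis
      using sum_Q_time_le_1[OF U, of "{x}" t] by simp
  next
    case (Suc j)
    then have "\<not> 1 / 2 ^ j \<le> ?q"
      using not_less_Least[of j "\<lambda>m. 1 / 2 ^ m \<le> ?q"] by (simp add: m0_def)
    then show ?thesis
      by (simp add: Suc field_simps)
  qed
  \<comment> \<open>The cap keeps the header of m short and can only decrease 2^m q. Where it takes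
    effect, m is the length of x and the coding bound holds without a condition on q.\<close>
  define m where "m = min m0 ?n"
  have "(2 :: real) ^ m \<le> 2 ^ m0"
    by (simp add: m_def)
  then have "2 ^ m * ?q \<le> 2 ^ m0 * ?q"
    using q by simp
  with m0_le have m_le: "2 ^ m * ?q \<le> 2" by linarith
  let ?h = "length (hdr ?n) + length (hdr m)"
  have "K_time U t' x \<le> enat (C + length (hdr ?n) + length (hdr m) + m)"
    using m0 by (intro coding) (auto simp: m_def min_def)
  then obtain k where k: "K_time U t' x = enat k" "k \<le> C + ?h + m"
    by (cases "K_time U t' x") (auto simp: add.assoc)
  have "(2 :: real) ^ k \<le> 2 ^ (C + ?h + m)"
    using k(2) by simp
  then have "Q U x * 2 ^ k \<le> (2 ^ b * ?q) * 2 ^ (C + ?h + m)"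
    using Q q by (intro mult_mono) auto
  also have "\<dots> = 2 ^ (b + C + ?h) * (2 ^ m * ?q)"
    by (simp add: power_add)
  also have "\<dots> \<le> 2 ^ (b + C + ?h) * 2"
    using m_le by simp
  also have "\<dots> = 2 ^ (b + 1 + C + ?h)"
    by (simp add: power_add)
  finally have "log 2 (Q U x * 2 ^ k) \<le> log 2 (2 ^ (b + 1 + C + ?h))"
    using Q(1) by (intro log_mono) auto
  also have "\<dots> = real (b + 1 + C + ?h)"
    by (rule log_pow_cancel) auto
  also have "\<dots> \<le> real b + 1 + real C + 2 * (sqrt (2 * real ?n) + 2)"
  proof -
    have "sqrt (2 * real m) \<le> sqrt (2 * real ?n)"
      by (simp add: m_def)
    with length_hdr_le[of m] have "real (length (hdr m)) \<le> sqrt (2 * real ?n) + 2"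
      by (rule order_trans[OF _ add_right_mono])
    from add_mono[OF length_hdr_le[of ?n] this] show ?thesis
      by simp
  qed
  finally show ?thesis
    unfolding depth_deficiency_finite[OF k(1)] ereal_less_eq by linarith
qed

lemma length_init_seg: "length (init_seg \<alpha> n) = n"
  by (simp add: init_seg_def)

text \<open>A positive limit inferior keeps the deficiency above cn for all large n, with a fixed c
  > 0, whereas every n of small depth would force it below a bound of order o(n). So only finitely
  many such n exist.\<close>

lemma super_deep_if_depth_dim_pos:
  assumes "universal_prefix_tm U" and pos: "\<And>t. recursive_fun t \<Longrightarrow> depth_dim U t \<alpha> > 0"
  shows "super_deep U \<alpha>"
  unfolding super_deep_def
proof (intro allI impI)
  fix s t :: "nat \<Rightarrow> nat"
  assume s: "(\<lambda>n. real (s n)) \<in> o(\<lambda>n. real n)" and t: "recursive_fun t"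
  have U: "prefix_tm U"
    using assms(1) by (simp add: universal_prefix_tm_def)
  obtain t' C where t': "recursive_fun t'" and coding:
    "\<And>x m. m \<le> length x \<Longrightarrow> m = length x \<or> 1 / 2 ^ m \<le> Q_time U t x \<Longrightarrow>
      K_time U t' x \<le> enat (C + length (hdr (length x)) + length (hdr m) + m)"
    using coding_theorem[OF assms(1) t] by blast
  define B where "B n = real (s n) + 1 + real C + 2 * (sqrt (2 * real n) + 2)" for n
  have "(\<lambda>n. real (s n) / real n + (1 + real C + 2 * (sqrt (2 * real n) + 2)) / real n) \<longlonglongrightarrow> 0 + 0"
  proof (rule tendsto_add)
    show "(\<lambda>n. real (s n) / real n) \<longlonglongrightarrow> 0"
      using s by (rule smalloD_tendsto)
    show "(\<lambda>n. (1 + real C + 2 * (sqrt (2 * real n) + 2)) / real n) \<longlonglongrightarrow> 0"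
      by real_asymp
  qed
  then have lim: "(\<lambda>n. B n / real n) \<longlonglongrightarrow> 0"
    by (simp add: B_def add_divide_distrib add.assoc)
  have "0 < depth_dim U t' \<alpha>"
    by (rule pos) (rule t')
  then obtain c where c: "0 < ereal c" "ereal c < depth_dim U t' \<alpha>"
    using ereal_dense2 by blast
  have "\<forall>\<^sub>F n in sequentially. ereal c < depth_deficiency U t' (init_seg \<alpha> n) / ereal (real n)"
    using c(2) unfolding depth_dim_def by (rule less_LiminfD)
  moreover have "\<forall>\<^sub>F n in sequentially. B n / real n < c"
    using order_tendstoD(2)[OF lim] c(1) by simp
  moreover have "\<forall>\<^sub>F n in sequentially. n > 0"
    by (rule eventually_gt_at_top)
  ultimately show "\<forall>\<^sub>F n in sequentially. ldepth U (s n) (init_seg \<alpha> n) > enat (t n)"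
  proof eventually_elim
    case (elim n)
    show ?case
    proof (rule ccontr)
      assume "\<not> ?thesis"
      then have "ldepth U (s n) (init_seg \<alpha> n) \<le> enat (t (length (init_seg \<alpha> n)))"
        by (simp add: length_init_seg)
      from depth_deficiency_le[where t = t, OF U coding this]
      have "depth_deficiency U t' (init_seg \<alpha> n) \<le> ereal (B n)"
        by (simp add: length_init_seg B_def)
      then have "depth_deficiency U t' (init_seg \<alpha> n) / ereal (real n) \<le> ereal (B n) / ereal (real n)"
        using elim(3) by (intro ereal_divide_right_mono) auto
      also have "\<dots> = ereal (B n / real n)"
        using elim(3) by simp
      also have "\<dots> < ereal c"
        using elim(2) by simp
      finally show False
        using elim(1) by simp
    qed
  qed
qed

text \<open>A single shortest program within time t contributes 2^-K to the time-bounded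
  probability, hence more than a fraction 2^-(\<delta> + 1) of \<open>Q\<close>. Where \<delta> is
  small compared to n, this witnesses small depth.\<close>

lemma depth_dim_pos_if_super_deep:
  assumes U: "prefix_tm U" and deep: "super_deep U \<alpha>" and t: "recursive_fun t"
  shows "depth_dim U t \<alpha> > 0"
proof (rule ccontr)
  assume "\<not> ?thesis"
  define \<delta> where "\<delta> n = depth_deficiency U t (init_seg \<alpha> n)" for n
  define X where "X n = \<delta> n / ereal (real n)" for n
  have \<delta>_nonneg: "0 \<le> \<delta> n" for n
    unfolding \<delta>_def by (rule depth_deficiency_nonneg[OF U])
  have depth: "depth_dim U t \<alpha> = liminf X"
    by (simp add: depth_dim_def X_def[abs_def] \<delta>_def)
  have "0 \<le> liminf X"
    by (rule Liminf_bounded) (simp add: X_def \<delta>_nonneg)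
  with \<open>\<not> ?thesis\<close> have "liminf X = 0"
    by (simp add: depth)
  then obtain r where r: "strict_mono r" "(X \<circ> r) \<longlonglongrightarrow> 0"
    using liminf_subseq_lim[of X] by auto
  define d where "d n = nat \<lfloor>real_of_ereal (\<delta> n)\<rfloor>" for n
  have d: "\<delta> n = ereal (real (d n))" if "\<delta> n \<noteq> \<infinity>" for n
  proof (cases "K_time U t (init_seg \<alpha> n)")
    case (enat k)
    show ?thesis
      using \<delta>_nonneg[of n] unfolding d_def \<delta>_def depth_deficiency_finite[OF enat] by simp
  next
    case infinity
    then show ?thesis using that by (simp add: \<delta>_def depth_deficiency_infinite)
  qed
  \<comment> \<open>The summand 1 compensates the floor in the deficiency. Off the subsequence 0
    will do, since the contradiction arises on the range of \<open>r\<close>, and it keeps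
    \<open>s\<close> in o(n).\<close>
  define s where "s n = (if n \<in> range r \<and> \<delta> n \<noteq> \<infinity> then d n + 1 else 0)" for n
  have small: "(\<lambda>n. real (s n)) \<in> o(\<lambda>n. real n)"
  proof (rule smalloI_tendsto)
    show "\<forall>\<^sub>F n in sequentially. real n \<noteq> 0"
      using eventually_gt_at_top[of 0] by eventually_elim simp
    show "(\<lambda>n. real (s n) / real n) \<longlonglongrightarrow> 0"
    proof (rule LIMSEQ_I)
      fix e :: real assume e: "0 < e"
      have "\<forall>\<^sub>F k in sequentially. (X \<circ> r) k < ereal (e / 2)"
        by (rule order_tendstoD(2)[OF r(2)]) (use e in simp)
      then obtain K where K: "\<And>k. k \<ge> K \<Longrightarrow> X (r k) < ereal (e / 2)"
        by (auto simp: eventually_sequentially)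
      \<comment> \<open>Beyond 2 / e the summand 1 of \<open>s\<close> costs less than e /
        2.\<close>
      obtain N :: nat where N: "2 / e < real N"
        using reals_Archimedean2 by blast
      have "norm (real (s n) / real n - 0) < e" if n: "n \<ge> max (r K) (Suc N)" for n
      proof (cases "n \<in> range r \<and> \<delta> n \<noteq> \<infinity>")
        case True
        then obtain k where k: "n = r k" by blast
        have "K \<le> k"
          using n r(1) unfolding k by (simp add: strict_mono_less_eq)
        then have "X n < ereal (e / 2)"
          using K k by simp
        then have "real (d n) / real n < e / 2"
          using d[of n] True n by (simp add: X_def)
        moreover have "1 / real n < e / 2"
        proof -
          have "2 / e < real n" using N n by simp
          then show ?thesis using e n by (simp add: field_simps)
        qed
        moreover have "real (s n) / real n = real (d n) / real n + 1 / real n"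
          using True by (simp add: s_def add_divide_distrib)
        moreover have "0 \<le> real (s n) / real n" by simp
        ultimately show ?thesis
          unfolding real_norm_def by linarith
      next
        case False
        then have "s n = 0" by (auto simp: s_def)
        with e show ?thesis by simp
      qed
      then show "\<exists>no. \<forall>n\<ge>no. norm (real (s n) / real n - 0) < e"
        by blast
    qed
  qed
  obtain \<tau> where \<tau>: "time_constructible \<tau>" "recursive_fun \<tau>" "\<And>n. t n \<le> \<tau> n"
    using time_constructible_above[OF t] by blast
  have "\<forall>\<^sub>F n in sequentially. ldepth U (s n) (init_seg \<alpha> n) > enat (\<tau> n)"
    using deep small \<tau>(2) unfolding super_deep_def by blast
  then have "\<forall>\<^sub>F k in sequentially. ldepth U (s (r k)) (init_seg \<alpha> (r k)) > enat (\<tau> (r k))"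
    by (rule eventually_compose_filterlim) (rule filterlim_subseq[OF r(1)])
  moreover have "\<forall>\<^sub>F k in sequentially. (X \<circ> r) k < 1"
    by (rule order_tendstoD(2)[OF r(2)]) simp
  moreover have "\<forall>\<^sub>F k in sequentially. r k > 0"
    by (rule eventually_compose_filterlim[OF eventually_gt_at_top filterlim_subseq[OF r(1)]])
  ultimately have "\<forall>\<^sub>F k in sequentially. False"
  proof eventually_elim
    case (elim k)
    let ?n = "r k" and ?x = "init_seg \<alpha> (r k)"
    \<comment> \<open>For positive n an infinite deficiency would make \<open>X n\<close> infinite,
      not below 1.\<close>
    have fin: "\<delta> ?n \<noteq> \<infinity>"
      using elim(2,3) by (auto simp: X_def)
    then have s: "s ?n = d ?n + 1"
      by (simp add: s_def)
    obtain l where l: "K_time U t ?x = enat l"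
      using fin by (cases "K_time U t ?x") (auto simp: \<delta>_def depth_deficiency_infinite)
    have one: "1 \<le> Q U ?x * 2 ^ l"
      by (rule one_le_Q_mult[OF U l])
    then have Q: "0 < Q U ?x"
      by (smt (verit) mult_nonpos_nonneg zero_le_power)
    have "real_of_int \<lfloor>log 2 (Q U ?x * 2 ^ l)\<rfloor> = real (d ?n)"
      using d[OF fin] by (simp add: \<delta>_def depth_deficiency_finite[OF l])
    then have "log 2 (Q U ?x * 2 ^ l) < real (s ?n)"
      unfolding s by linarith
    then have "Q U ?x * 2 ^ l < 2 powr real (s ?n)"
      using one by (simp add: log_less_iff)
    then have less: "Q U ?x * 2 ^ l < 2 ^ s ?n"
      by (simp add: powr_realpow)
    obtain p where p: "computes_within U p (t (length ?x)) ?x" "length p = l"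
      using l by (rule K_time_eq_enatE)
    have "1 / 2 ^ l \<le> Q_time U \<tau> ?x"
      using wt_le_Q_time[OF U, of p \<tau> ?x] computes_within_mono[OF p(1) \<tau>(3)] p(2) by simp
    moreover have "Q U ?x / 2 ^ s ?n \<le> 1 / 2 ^ l"
      using less by (simp add: field_simps)
    ultimately have "Q U ?x / 2 ^ s ?n \<le> Q_time U \<tau> ?x"
      by linarith
    then have "1 / 2 ^ s ?n \<le> Q_time U \<tau> ?x / Q U ?x"
      using Q by (simp add: field_simps)
    then have "ldepth U (s ?n) ?x \<le> enat (\<tau> (length ?x))"
      unfolding ldepth_def using \<tau>(1) by (intro INF_lower) simp
    then show False
      using elim(1) by (simp add: length_init_seg)
  qed
  then show False by simp
qed

theorem theorem5:
  fixes U :: tm and \<alpha> :: "nat \<Rightarrow> bool"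
  assumes "universal_prefix_tm U"
  shows "super_deep U \<alpha> \<longleftrightarrow> (\<forall>t. recursive_fun t \<longrightarrow> depth_dim U t \<alpha> > 0)"
  using super_deep_if_depth_dim_pos[OF assms] depth_dim_pos_if_super_deep[of U \<alpha>] assms
  unfolding universal_prefix_tm_def by blast

end
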